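(* Let $X$ be a Banach space and $N \in \mathbb{N}$. Suppose that there exist $x_0 \in X \setminus \{0\}$ and $x_1^*, \ldots, x_{N-1}^* \in X^* \setminus \{0\}$ such that the set \[ \{ x^* \in X^* : P_{x_1^*,\ldots,x_{N-1}^*, x^*; x_0} \text{ attains its numerical radius} \} \] has non-empty interior in the weak-star topology of $X^*$. Then $X$ is reflexive.
   Context: Banach spaces are over $\mathbb{K}=\mathbb{R}$ or $\mathbb{C}$. $S_X$ is the unit sphere of $X$, and $\Pi(X) = \{(x,x^* ) \in S_X \times S_{X^*} : x^*(x)=1\}$. For $x_1^*,\ldots,x_{N-1}^*, x^* \in X^*$ and $x_0 \in X$, $P_{x_1^*,\ldots,x_{N-1}^*, x^*; x_0}$ denotes the $N$-homogeneous polynomial from $X$ into $X$ given by $x \mapsto x_1^*(x) \cdots x_{N-1}^*(x)\, x^*(x)\, x_0$ (for $N=1$ there are no functionals $x_i^*$ and it is $x \mapsto x^*(x)x_0$). The numerical radius of an $N$-homogeneous polynomial $P : X \to X$ is $\nu(P) = \sup\{|x^*(P(x))| : (x,x^* ) \in \Pi(X)\}$, and $P$ attains its numerical radius if $\nu(P) = |x^*(P(x))|$ for some $(x,x^* ) \in \Pi(X)$. *)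

theory Defs
  imports "HOL-Analysis.Analysis"
begin

text \<open>
  The type class \<open>banach\<close> only provides real scalars. A Banach space over a field \<open>'k\<close> is a type of
  this class together with a scalar multiplication \<open>smul\<close> by elements of \<open>'k\<close> that extends the real one
  and makes the norm homogeneous. It is used for \<open>'k = complex\<close>, and for \<open>'k = real\<close> with
  \<open>smul = scaleR\<close>.
\<close>

locale banach_space_over = vector_space smul
  for smul :: "'k::real_normed_field \<Rightarrow> 'a::banach \<Rightarrow> 'a" +
  assumes norm_smul: "norm (smul c x) = norm c * norm x"
    and smul_of_real: "smul (of_real r) x = r *\<^sub>R x"

lemma banach_space_over_scaleR: "banach_space_over (scaleR :: real \<Rightarrow> 'a::banach \<Rightarrow> 'a)"
  by unfold_locales (simp_all add: algebra_simps)

lemma banach_space_over_complex: "banach_space_over ((*) :: complex \<Rightarrow> complex \<Rightarrow> complex)"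
  by unfold_locales (simp_all add: algebra_simps norm_mult scaleR_conv_of_real)

text \<open>
  \<open>bounded_linear\<close> is real linearity and continuity, so homogeneity over \<open>'k\<close> is a separate condition.
  The norm of the dual is \<open>onorm\<close>.
\<close>

definition dual :: "('k::real_normed_field \<Rightarrow> 'a::real_normed_vector \<Rightarrow> 'a) \<Rightarrow> ('a \<Rightarrow> 'k) set" where
  "dual smul = {f. bounded_linear f \<and> (\<forall>c x. f (smul c x) = c * f x)}"

lemma dual_scaleR: "dual (scaleR :: real \<Rightarrow> 'a::real_normed_vector \<Rightarrow> 'a) = Collect bounded_linear"
  by (auto simp: dual_def linear_simps)

text \<open>The topology of pointwise convergence on the dual.\<close>

definition weak_star :: "('k::real_normed_field \<Rightarrow> 'a::real_normed_vector \<Rightarrow> 'a) \<Rightarrow> ('a \<Rightarrow> 'k) topology" where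
  "weak_star smul = subtopology (product_topology (\<lambda>_. euclidean) UNIV) (dual smul)"

lemma topspace_weak_star [simp]: "topspace (weak_star smul) = dual smul"
  by (simp add: weak_star_def)

text \<open>Values outside \<open>dual smul\<close> are irrelevant for members of the bidual.\<close>

definition bidual :: "('k::real_normed_field \<Rightarrow> 'a::real_normed_vector \<Rightarrow> 'a) \<Rightarrow> (('a \<Rightarrow> 'k) \<Rightarrow> 'k) set" where
  "bidual smul = {\<Phi>.
     (\<forall>f\<in>dual smul. \<forall>g\<in>dual smul. \<Phi> (\<lambda>x. f x + g x) = \<Phi> f + \<Phi> g) \<and>
     (\<forall>c. \<forall>f\<in>dual smul. \<Phi> (\<lambda>x. c * f x) = c * \<Phi> f) \<and>
     (\<exists>C. \<forall>f\<in>dual smul. norm (\<Phi> f) \<le> C * onorm f)}"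

text \<open>Surjectivity of the canonical embedding into the bidual.\<close>

definition reflexive_space :: "('k::real_normed_field \<Rightarrow> 'a::real_normed_vector \<Rightarrow> 'a) \<Rightarrow> bool" where
  "reflexive_space smul \<longleftrightarrow> (\<forall>\<Phi>\<in>bidual smul. \<exists>x. \<forall>f\<in>dual smul. \<Phi> f = f x)"

definition state_pairs ::
    "('k::real_normed_field \<Rightarrow> 'a::real_normed_vector \<Rightarrow> 'a) \<Rightarrow> ('a \<times> ('a \<Rightarrow> 'k)) set" where
  "state_pairs smul = {(x, f). norm x = 1 \<and> f \<in> dual smul \<and> onorm f = 1 \<and> f x = 1}"

text \<open>
  For a continuous homogeneous polynomial on a nonzero space this is the supremum of a nonempty
  bounded set of reals, so \<open>Sup\<close> on \<open>real\<close> has its intended value.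
\<close>

definition numerical_radius ::
    "('k::real_normed_field \<Rightarrow> 'a::real_normed_vector \<Rightarrow> 'a) \<Rightarrow> ('a \<Rightarrow> 'a) \<Rightarrow> real" where
  "numerical_radius smul P = (SUP (x, f)\<in>state_pairs smul. norm (f (P x)))"

definition attains_numerical_radius ::
    "('k::real_normed_field \<Rightarrow> 'a::real_normed_vector \<Rightarrow> 'a) \<Rightarrow> ('a \<Rightarrow> 'a) \<Rightarrow> bool" where
  "attains_numerical_radius smul P \<longleftrightarrow>
     (\<exists>(x, f)\<in>state_pairs smul. numerical_radius smul P = norm (f (P x)))"

text \<open>Only the functionals \<open>xs 1, \<dots>, xs (N - 1)\<close> are used; the product is \<open>1\<close> for \<open>N = 1\<close>.\<close>

definition product_poly ::
    "('k::real_normed_field \<Rightarrow> 'a::real_normed_vector \<Rightarrow> 'a) \<Rightarrow>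
     nat \<Rightarrow> (nat \<Rightarrow> 'a \<Rightarrow> 'k) \<Rightarrow> ('a \<Rightarrow> 'k) \<Rightarrow> 'a \<Rightarrow> 'a \<Rightarrow> 'a" where
  "product_poly smul N xs f x0 = (\<lambda>x. smul ((\<Prod>i\<in>{1..N - 1}. xs i x) * f x) x0)"

end

theory Submission
  imports Defs "HOL-Library.Diagonal_Subsequence"
begin

text \<open>
  Write \<open>p\<close> for the product of the functionals \<open>xs i\<close>. A state pair \<open>(x, g)\<close> evaluates the polynomial
  of \<open>f\<close> to \<open>p x * f x * g x0\<close>. The polynomial therefore attains its numerical radius exactly when
  \<open>|f|\<close> attains its supremum on the bounded balanced set \<open>B\<close> of all vectors \<open>c p(x) g(x0) x\<close> with
  \<open>|c| = 1\<close> (\<open>radius_set\<close>, \<open>attains_max_on_radius_set\<close>). Two observations turn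
  the statement into a question about suprema of real functionals on \<open>B\<close>.

  First, \<open>B\<close> is large: its real span is the whole space (\<open>span_radius_set\<close>). If \<open>x + t x0\<close> is shorter
  than \<open>x\<close> for some \<open>t\<close>, then no functional supporting the ball at \<open>x\<close> vanishes at \<open>x0\<close>, so \<open>x\<close> is a
  multiple of an element of \<open>B\<close> unless \<open>p x = 0\<close>; and every vector is a combination of such \<open>x\<close> with
  \<open>p x \<noteq> 0\<close>, because \<open>y + s x0\<close> has both properties for almost all large \<open>s\<close> if \<open>p y \<noteq> 0\<close>. By the Banach-Steinhaus theorem, the supremum over \<open>B\<close>
  is then a norm on the dual that is equivalent to the original one. Secondly, a weak-star
  neighbourhood of \<open>f0\<close> contains every functional that agrees with \<open>f0\<close> on a suitable finite set \<open>Y\<close>.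

  What remains is a form of James' theorem (\<open>james_perturbed\<close>) for real spaces: if \<open>f0 + g\<close> attains its
  supremum on \<open>B\<close> for all \<open>g\<close> that vanish on the finite set \<open>Y\<close>, then \<open>X\<close> is reflexive. Suppose not. A
  functional on the dual at positive distance from \<open>X\<close> yields, by the Hahn-Banach theorem and Helly's
  theorem, functionals \<open>f n\<close> in the unit ball that vanish on \<open>Y\<close>, and bounded vectors \<open>x m\<close>, with
  \<open>f n (x m) = 0\<close> for \<open>m < n\<close> and \<open>f n (x m) \<ge> \<theta> > 0\<close> for \<open>n \<le> m\<close>. Hence convex combinations of the \<open>f n\<close>
  stay away from all generalized limits of the sequence. A diagonal argument of Pryce provides a
  subsequence for which \<open>sup\<^sub>B (h - c liminf f)\<close> and \<open>sup\<^sub>B (h - c limsup f)\<close> agree for all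
  relevant \<open>h\<close> and \<open>c\<close>, so that one may calculate with the \<open>limsup\<close> although the limit functional has not
  yet been chosen. Minimizing successively (\<open>james_sequence\<close>), one chooses \<open>h n\<close> in the convex hull
  of the \<open>f k\<close> with \<open>k \<ge> n\<close>, and rapidly decreasing weights \<open>\<beta> n\<close>, such that the supremum of
  \<open>f0 + (\<Sum>i<n. \<beta> i (h i - limsup f))\<close> grows by a definite multiple of \<open>\<beta> n\<close> at step \<open>n\<close>. For a
  generalized limit \<open>w\<close> of the \<open>h n\<close> themselves, \<open>f0 + (\<Sum>i. \<beta> i (h i - w))\<close> cannot attain its supremum:
  at a maximizer \<open>b\<close> all differences \<open>h n b - w b\<close> would exceed one fixed positive constant, whereas
  \<open>w b\<close> is at least the lower limit of \<open>h n b\<close>.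

  Real and complex scalars are treated together in the locale \<open>real_functionals\<close>, which records how
  real functionals arise as real parts of functionals over the scalar field.
\<close>

section \<open>Sublinear functionals and the Hahn-Banach theorem\<close>

definition sublinear :: "('a::real_vector \<Rightarrow> real) \<Rightarrow> bool" where
  "sublinear p \<longleftrightarrow> (\<forall>x y. p (x + y) \<le> p x + p y) \<and> (\<forall>t x. t \<ge> 0 \<longrightarrow> p (t *\<^sub>R x) = t * p x)"

lemma sublinearD:
  assumes "sublinear p"
  shows "p (x + y) \<le> p x + p y" "t \<ge> 0 \<Longrightarrow> p (t *\<^sub>R x) = t * p x"
    "p 0 = 0" "- p (- x) \<le> p x"
proof -
  show 1: "p (x + y) \<le> p x + p y" for x y using assms by (auto simp: sublinear_def)
  show 2: "t \<ge> 0 \<Longrightarrow> p (t *\<^sub>R x) = t * p x" for t x using assms by (auto simp: sublinear_def)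
  show 3: "p 0 = 0" using 2[of 0 0] by simp
  show "- p (- x) \<le> p x" using 1[of x "- x"] 3 by simp
qed

text \<open>
  For a convex cone \<open>S\<close> of pairs with \<open>a \<le> p k\<close>, this is the largest
  sublinear functional \<open>q \<le> p\<close> with \<open>q (- k) \<le> - a\<close> for all \<open>(k,
  a)\<close> in \<open>S\<close>. Every linear functional below it therefore satisfies \<open>a \<le> F
  k\<close>.
\<close>

definition cone_lowering :: "('a::real_vector \<Rightarrow> real) \<Rightarrow> ('a \<times> real) set \<Rightarrow> 'a \<Rightarrow> real" where
  "cone_lowering p S x = (INF (k, a)\<in>S. p (x + k) - a)"

lemma
  fixes S :: "('a::real_vector \<times> real) set"
  assumes p: "sublinear p" and S: "convex_cone S" and below: "\<And>k a. (k, a) \<in> S \<Longrightarrow> a \<le> p k"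
  shows sublinear_cone_lowering: "sublinear (cone_lowering p S)"
    and cone_lowering_le: "(k, a) \<in> S \<Longrightarrow> cone_lowering p S x \<le> p (x + k) - a"
    and cone_lowering_le_self: "cone_lowering p S x \<le> p x"
proof -
  note S0 = convex_cone_contains_0[OF S] and add = convex_cone_add[OF S] and scale = convex_cone_scaleR[OF S]
  have lb: "- p (- x) \<le> p (x + k) - a" if "(k, a) \<in> S" for x k a
    using sublinearD(1)[OF p, of "x + k" "- x"] below[OF that] by simp
  have bdd: "bdd_below ((\<lambda>(k, a). p (x + k) - a) ` S)" for x
    using lb by (intro bdd_belowI[of _ "- p (- x)"]) auto
  have ne: "(\<lambda>(k, a). p (x + k) - a) ` S \<noteq> {}" for x using S0 by auto
  show le: "cone_lowering p S x \<le> p (x + k) - a" if "(k, a) \<in> S" for x k a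
    unfolding cone_lowering_def using cINF_lower[OF bdd that] by simp
  show "cone_lowering p S x \<le> p x" for x using le[of 0 0 x] S0 by (simp add: zero_prod_def)
  have greatest: "c \<le> cone_lowering p S x" if "\<And>k a. (k, a) \<in> S \<Longrightarrow> c \<le> p (x + k) - a" for c x
    unfolding cone_lowering_def by (rule cINF_greatest) (use S0 that in auto)
  have zero: "cone_lowering p S 0 = 0"
    using le[of 0 0 0] S0 greatest[of 0 0] below sublinearD(3)[OF p]
    by (force simp: zero_prod_def intro: antisym)
  have scale_le: "cone_lowering p S (t *\<^sub>R x) \<le> t * cone_lowering p S x" if t: "t > 0" for t x
  proof -
    have "cone_lowering p S (t *\<^sub>R x) / t \<le> cone_lowering p S x"
    proof (rule greatest)
      fix k a assume ka: "(k, a) \<in> S"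
      have "(t *\<^sub>R k, t * a) \<in> S" using scale[OF _ ka, of t] t by simp
      from le[OF this, of "t *\<^sub>R x"] have "cone_lowering p S (t *\<^sub>R x) \<le> t * (p (x + k) - a)"
        using sublinearD(2)[OF p, of t "x + k"] t by (simp add: algebra_simps)
      then show "cone_lowering p S (t *\<^sub>R x) / t \<le> p (x + k) - a"
        using t by (simp add: field_simps)
    qed
    then show ?thesis using t by (simp add: field_simps)
  qed
  show "sublinear (cone_lowering p S)"
    unfolding sublinear_def
  proof (intro conjI allI impI)
    fix x y
    have "cone_lowering p S (x + y) - cone_lowering p S y \<le> cone_lowering p S x"
    proof (rule greatest)
      fix k a assume ka: "(k, a) \<in> S"
      have "cone_lowering p S (x + y) - (p (x + k) - a) \<le> cone_lowering p S y"
      proof (rule greatest)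
        fix l b assume lb: "(l, b) \<in> S"
        have "(k + l, a + b) \<in> S" using add[OF ka lb] by simp
        from le[OF this, of "x + y"]
        show "cone_lowering p S (x + y) - (p (x + k) - a) \<le> p (y + l) - b"
          using sublinearD(1)[OF p, of "x + k" "y + l"] by (simp add: algebra_simps)
      qed
      then show "cone_lowering p S (x + y) - cone_lowering p S y \<le> p (x + k) - a" by simp
    qed
    then show "cone_lowering p S (x + y) \<le> cone_lowering p S x + cone_lowering p S y" by simp
  next
    fix t :: real and x :: 'a assume "t \<ge> 0"
    show "cone_lowering p S (t *\<^sub>R x) = t * cone_lowering p S x"
    proof (cases "t = 0")
      case False
      with \<open>t \<ge> 0\<close> have t: "t > 0" by simp
      have "cone_lowering p S ((1/t) *\<^sub>R (t *\<^sub>R x)) \<le> (1/t) * cone_lowering p S (t *\<^sub>R x)"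
        by (rule scale_le) (use t in simp)
      then have "t * cone_lowering p S x \<le> cone_lowering p S (t *\<^sub>R x)"
        using t by (simp add: field_simps)
      with scale_le[OF t] show ?thesis by (simp add: antisym)
    qed (simp add: zero)
  qed
qed

text \<open>
  By Zorn's lemma. The pointwise infimum of a chain is finite because every sublinear \<open>q \<le>
  p\<close> satisfies \<open>- p (- x) \<le> q x\<close>.
\<close>

lemma exists_minimal_sublinear:
  assumes p: "sublinear (p :: 'a::real_vector \<Rightarrow> real)"
  obtains q where "sublinear q" "\<And>x. q x \<le> p x"
    "\<And>q'. sublinear q' \<Longrightarrow> (\<And>x. q' x \<le> q x) \<Longrightarrow> q' = q"
proof -
  define A where "A = {q. sublinear q \<and> (\<forall>x. q x \<le> p x)}"
  define P :: "('a \<Rightarrow> real) \<Rightarrow> ('a \<Rightarrow> real) \<Rightarrow> bool" where "P q q' \<longleftrightarrow> (\<forall>x. q' x \<le> q x)" for q q'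
  have "\<exists>m\<in>A. \<forall>a\<in>A. P m a \<longrightarrow> a = m"
  proof (rule predicate_Zorn)
    show "partial_order_on A (relation_of P A)"
      by (rule partial_order_on_relation_ofI)
        (auto simp: P_def intro!: ext intro: order_trans antisym)
  next
    fix C assume C: "C \<in> Chains (relation_of P A)"
    then have CA: "C \<subseteq> A" by (auto simp: Chains_def relation_of_def)
    have tot: "P a b \<or> P b a" if "a \<in> C" "b \<in> C" for a b
      using C that by (auto simp: Chains_def relation_of_def)
    show "\<exists>u\<in>A. \<forall>a\<in>C. P a u"
    proof (cases "C = {}")
      case True
      then show ?thesis using p by (auto simp: A_def)
    next
      case False
      define q where "q x = (INF a\<in>C. a x)" for x
      have lb: "- p (- x) \<le> a x" if "a \<in> C" for a x
      proof -
        have a: "sublinear a" "a (- x) \<le> p (- x)" using that CA by (auto simp: A_def)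
        from sublinearD(4)[OF a(1), of x] a(2) show ?thesis by linarith
      qed
      have bdd: "bdd_below ((\<lambda>a. a x) ` C)" for x
        using lb by (intro bdd_belowI[of _ "- p (- x)"]) auto
      have le: "q x \<le> a x" if "a \<in> C" for a x
        unfolding q_def by (rule cINF_lower[OF bdd that])
      have greatest: "c \<le> q x" if "\<And>a. a \<in> C \<Longrightarrow> c \<le> a x" for c x
        unfolding q_def by (rule cINF_greatest[OF False that])
      have "sublinear q"
        unfolding sublinear_def
      proof (intro conjI allI impI)
        fix x y
        have "q (x + y) - q y \<le> q x"
        proof (rule greatest)
          fix a assume a: "a \<in> C"
          have "q (x + y) - a x \<le> q y"
          proof (rule greatest)
            fix b assume b: "b \<in> C"
            have sub: "sublinear a" "sublinear b" using a b CA by (auto simp: A_def)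
            (* The smaller of the two chain members estimates both summands. *)
            from tot[OF a b] show "q (x + y) - a x \<le> b y"
            proof
              assume "P a b"
              then have "b x \<le> a x" by (simp add: P_def)
              then show ?thesis using le[OF b, of "x + y"] sublinearD(1)[OF sub(2), of x y] by linarith
            next
              assume "P b a"
              then have "a y \<le> b y" by (simp add: P_def)
              then show ?thesis using le[OF a, of "x + y"] sublinearD(1)[OF sub(1), of x y] by linarith
            qed
          qed
          then show "q (x + y) - q y \<le> a x" by simp
        qed
        then show "q (x + y) \<le> q x + q y" by simp
      next
        fix t :: real and x :: 'a assume "t \<ge> 0"
        have hom: "a (t *\<^sub>R x) = t * a x" if "a \<in> C" for a
          using sublinearD(2)[of a t x] that CA \<open>t \<ge> 0\<close> by (auto simp: A_def)
        show "q (t *\<^sub>R x) = t * q x"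
        proof (cases "t = 0")
          case True
          have "(\<lambda>a. a 0) ` C = {0}" using False hom True by (auto intro: rev_image_eqI)
          then have "q 0 = 0" by (simp add: q_def)
          then show ?thesis using True by simp
        next
          case False
          with \<open>t \<ge> 0\<close> have t: "t > 0" by simp
          have "t * q x \<le> q (t *\<^sub>R x)"
          proof (rule greatest)
            fix a assume a: "a \<in> C"
            then show "t * q x \<le> a (t *\<^sub>R x)" using t le[OF a, of x] hom[OF a] by simp
          qed
          moreover have "q (t *\<^sub>R x) / t \<le> q x"
          proof (rule greatest)
            fix a assume a: "a \<in> C"
            then show "q (t *\<^sub>R x) / t \<le> a x"
              using t le[OF a, of "t *\<^sub>R x"] hom[OF a] by (simp add: field_simps)
          qed
          ultimately show ?thesis using t by (simp add: field_simps)
        qed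
      qed
      moreover have "q x \<le> p x" for x
      proof -
        obtain a where "a \<in> C" using False by auto
        then have "q x \<le> a x" "a x \<le> p x" using le CA by (auto simp: A_def)
        then show ?thesis by linarith
      qed
      ultimately show ?thesis using le by (auto simp: A_def P_def)
    qed
  qed
  then obtain m where m: "m \<in> A" "\<And>a. a \<in> A \<Longrightarrow> P m a \<Longrightarrow> a = m" by blast
  show thesis
  proof (rule that)
    fix q' assume "sublinear q'" "\<And>x. q' x \<le> m x"
    then have "q' \<in> A" "P m q'" using m(1) order_trans unfolding A_def P_def by blast+
    then show "q' = m" by (rule m(2))
  qed (use m in \<open>auto simp: A_def\<close>)
qed

lemma convex_cone_ray: "convex_cone (range (\<lambda>t. max 0 t *\<^sub>R (v :: 'a::real_vector)))"
proof -
  have "range (\<lambda>t. max 0 t *\<^sub>R v) = (\<lambda>t. t *\<^sub>R v) ` {0..}"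
    by (auto simp: image_def intro: exI[of _ "max 0 _"] bexI[of _ "max 0 _"]) (metis max.absorb2)
  moreover have "convex_cone {0::real..}" by (simp add: convex_cone_iff)
  moreover have "linear (\<lambda>t. t *\<^sub>R v)" by (simp add: linear_iff algebra_simps)
  ultimately show ?thesis using convex_cone_linear_image by fastforce
qed

lemma ray_below_sublinear:
  assumes "sublinear p" "(k, a) \<in> range (\<lambda>t. max 0 t *\<^sub>R (z, p z))"
  shows "a \<le> p k"
  using assms sublinearD(2)[OF assms(1), of _ z] by auto

lemma mem_ray: "(v :: 'a::real_vector) \<in> range (\<lambda>t. max 0 t *\<^sub>R v)"
  by (rule range_eqI[of _ _ 1]) simp

text \<open>
  A minimal sublinear \<open>q\<close> is linear: lowering it along the ray through \<open>z\<close>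
  gives nothing new, and this says \<open>q x + q z \<le> q (x + z)\<close>.
\<close>

lemma exists_linear_le_sublinear:
  assumes p: "sublinear (p :: 'a::real_vector \<Rightarrow> real)"
  obtains F where "linear F" "\<And>x. F x \<le> p x"
proof -
  obtain q where q: "sublinear q" "\<And>x. q x \<le> p x"
    and min: "\<And>q'. sublinear q' \<Longrightarrow> (\<And>x. q' x \<le> q x) \<Longrightarrow> q' = q"
    using exists_minimal_sublinear[OF p] by blast
  have "q x + q z \<le> q (x + z)" for x z
  proof -
    note ray = convex_cone_ray[of "(z, q z)"] ray_below_sublinear[OF q(1), of _ _ z]
    have "cone_lowering q (range (\<lambda>t. max 0 t *\<^sub>R (z, q z))) = q"
      by (intro min sublinear_cone_lowering cone_lowering_le_self q(1) ray)
    then show ?thesis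
      using cone_lowering_le[OF q(1) ray mem_ray[of "(z, q z)"], of x] by simp
  qed
  then have add: "q (x + z) = q x + q z" for x z using sublinearD(1)[OF q(1)] by (simp add: antisym)
  have neg: "q (- x) = - q x" for x using add[of x "- x"] sublinearD(3)[OF q(1)] by simp
  have "linear q"
  proof (rule linearI)
    show "q (t *\<^sub>R x) = t *\<^sub>R q x" for t x
      using sublinearD(2)[OF q(1), of t x] sublinearD(2)[OF q(1), of "- t" x] neg[of "t *\<^sub>R x"]
      by (cases "t \<ge> 0") auto
  qed (rule add)
  with q(2) that show thesis by blast
qed

text \<open>
  Prescribing lower bounds on a convex cone covers both uses below: a value at a single point (the cone
  is a ray) and the extension of a functional from a subspace (the cone is its graph).
\<close>

theorem hahn_banach_cone:
  fixes S :: "('a::real_vector \<times> real) set"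
  assumes p: "sublinear p" and S: "convex_cone S" "\<And>k a. (k, a) \<in> S \<Longrightarrow> a \<le> p k"
  obtains F where "linear F" "\<And>x. F x \<le> p x" "\<And>k a. (k, a) \<in> S \<Longrightarrow> a \<le> F k"
proof -
  obtain F where F: "linear F" "\<And>x. F x \<le> cone_lowering p S x"
    using exists_linear_le_sublinear[OF sublinear_cone_lowering[OF p S]] by blast
  show thesis
  proof (rule that[OF F(1)])
    show "F x \<le> p x" for x
      using F(2)[of x] cone_lowering_le_self[OF p S, of x] by simp
    show "a \<le> F k" if "(k, a) \<in> S" for k a
      using F(2)[of "- k"] cone_lowering_le[OF p S that, of "- k"] sublinearD(3)[OF p]
        linear_neg[OF F(1), of k] by simp
  qed
qed

corollary hahn_banach_support:
  assumes p: "sublinear (p :: 'a::real_vector \<Rightarrow> real)"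
  obtains F where "linear F" "\<And>x. F x \<le> p x" "F z = p z"
proof -
  note ray = convex_cone_ray[of "(z, p z)"] ray_below_sublinear[OF p, of _ _ z]
  show thesis
  proof (rule hahn_banach_cone[OF p ray])
    fix F assume F: "linear F" "\<And>x. F x \<le> p x"
      "\<And>k a. (k, a) \<in> range (\<lambda>t. max 0 t *\<^sub>R (z, p z)) \<Longrightarrow> a \<le> F k"
    show thesis by (rule that[OF F(1,2)]) (simp add: antisym F(2) F(3)[OF mem_ray])
  qed
qed

corollary hahn_banach_subspace:
  assumes p: "sublinear (p :: 'a::real_vector \<Rightarrow> real)" and S: "subspace S" and f: "linear f"
    and le: "\<And>x. x \<in> S \<Longrightarrow> f x \<le> p x"
  obtains F where "linear F" "\<And>x. F x \<le> p x" "\<And>x. x \<in> S \<Longrightarrow> F x = f x"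
proof -
  let ?S = "(\<lambda>x. (x, f x)) ` S"
  have "linear (\<lambda>x. (x, f x))" by (simp add: linear_iff linear_add[OF f] linear_cmul[OF f])
  moreover have "convex_cone S"
    using S by (auto simp: convex_cone_iff subspace_def)
  ultimately have cone: "convex_cone ?S" by (intro convex_cone_linear_image conjI)
  have below: "a \<le> p k" if "(k, a) \<in> ?S" for k a using that le by auto
  obtain F where F: "linear F" "\<And>x. F x \<le> p x" "\<And>k a. (k, a) \<in> ?S \<Longrightarrow> a \<le> F k"
    using hahn_banach_cone[OF p cone below] by blast
  show thesis
  proof (rule that[OF F(1,2)])
    fix x assume "x \<in> S"
    then have "f x \<le> F x" "f (- x) \<le> F (- x)" using F(3) subspace_neg[OF S] by auto
    then show "F x = f x" using linear_neg[OF F(1)] linear_neg[OF f] by simp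
  qed
qed

section \<open>Upper limits of bounded real sequences\<close>

text \<open>
  The upper limit as a real number. Its value is meaningful for bounded sequences only. The lower limit
  of \<open>s\<close> is written as \<open>- real_limsup (\<lambda>k. - s k)\<close>.
\<close>

definition real_limsup :: "(nat \<Rightarrow> real) \<Rightarrow> real" where
  "real_limsup s = Inf {c. \<forall>\<^sub>F k in sequentially. s k \<le> c}"

lemma real_limsup_le:
  assumes "Bseq s" "\<forall>\<^sub>F k in sequentially. s k \<le> c"
  shows "real_limsup s \<le> c"
proof -
  obtain K where K: "\<And>k. \<bar>s k\<bar> \<le> K" using assms(1) by (auto simp: Bseq_def)
  have "bdd_below {c. \<forall>\<^sub>F k in sequentially. s k \<le> c}"
  proof (rule bdd_belowI)
    fix d assume "d \<in> {c. \<forall>\<^sub>F k in sequentially. s k \<le> c}"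
    then obtain k where "s k \<le> d" using eventually_happens'[OF sequentially_bot] by auto
    then show "- K \<le> d" using K[of k] by linarith
  qed
  then show ?thesis unfolding real_limsup_def by (rule cInf_lower[rotated]) (use assms(2) in simp)
qed

lemma eventually_le_of_real_limsup_less:
  assumes "Bseq s" "real_limsup s < c"
  shows "\<forall>\<^sub>F k in sequentially. s k \<le> c"
proof -
  obtain K where K: "\<And>k. \<bar>s k\<bar> \<le> K" using assms(1) by (auto simp: Bseq_def)
  then have "K \<in> {c. \<forall>\<^sub>F k in sequentially. s k \<le> c}" by (simp add: abs_le_D1)
  then obtain d where "\<forall>\<^sub>F k in sequentially. s k \<le> d" "d < c"
    using assms(2) cInf_lessD[of "{c. \<forall>\<^sub>F k in sequentially. s k \<le> c}" c]
    unfolding real_limsup_def by blast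
  then show ?thesis by (auto elim!: eventually_mono)
qed

lemma real_limsup_ge:
  assumes "Bseq s" "\<exists>\<^sub>F k in sequentially. c \<le> s k"
  shows "c \<le> real_limsup s"
proof (rule ccontr)
  assume "\<not> c \<le> real_limsup s"
  then obtain d where d: "real_limsup s < d" "d < c" using dense by (metis not_le)
  have "\<forall>\<^sub>F k in sequentially. \<not> c \<le> s k"
    using eventually_le_of_real_limsup_less[OF assms(1) d(1)] d(2) by (auto elim!: eventually_mono)
  then show False using assms(2) by (simp add: frequently_def)
qed

lemma real_limsup_mono_eventually:
  assumes "Bseq s" "Bseq t" "\<And>c. \<forall>\<^sub>F k in sequentially. t k \<le> c \<Longrightarrow> \<forall>\<^sub>F k in sequentially. s k \<le> c"
  shows "real_limsup s \<le> real_limsup t"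
proof (rule dense_ge)
  fix c assume "real_limsup t < c"
  then show "real_limsup s \<le> c"
    by (intro real_limsup_le assms(1) assms(3) eventually_le_of_real_limsup_less[OF assms(2)])
qed

lemma Bseq_plus:
  fixes s t :: "nat \<Rightarrow> 'a::real_normed_vector"
  assumes "Bseq s" "Bseq t"
  shows "Bseq (\<lambda>k. s k + t k)"
proof -
  obtain K L where "\<And>k. norm (s k) \<le> K" "\<And>k. norm (t k) \<le> L"
    using assms by (auto simp: Bseq_def)
  then have "norm (s k + t k) \<le> K + L" for k using norm_triangle_mono by blast
  then show ?thesis by (rule BseqI')
qed

lemma real_limsup_add_le:
  assumes "Bseq s" "Bseq t"
  shows "real_limsup (\<lambda>k. s k + t k) \<le> real_limsup s + real_limsup t"
proof (rule field_le_epsilon)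
  fix e :: real assume e: "e > 0"
  have "\<forall>\<^sub>F k in sequentially. s k \<le> real_limsup s + e/2"
    "\<forall>\<^sub>F k in sequentially. t k \<le> real_limsup t + e/2"
    using e assms by (auto intro!: eventually_le_of_real_limsup_less)
  then have "\<forall>\<^sub>F k in sequentially. s k + t k \<le> real_limsup s + real_limsup t + e"
    by eventually_elim (simp add: field_simps)
  then show "real_limsup (\<lambda>k. s k + t k) \<le> real_limsup s + real_limsup t + e"
    by (rule real_limsup_le[OF Bseq_plus[OF assms]])
qed

lemma real_limsup_cmult:
  assumes "Bseq s" "c \<ge> 0"
  shows "real_limsup (\<lambda>k. c * s k) = c * real_limsup s"
proof (cases "c = 0")
  case True
  have "Bseq (\<lambda>_. 0 :: real)" by (rule BseqI'[of _ 0]) simp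
  from real_limsup_le[OF this, of 0] real_limsup_ge[OF this, of 0]
  have "real_limsup (\<lambda>_. 0) = 0" by simp
  with True show ?thesis by simp
next
  case False
  with assms(2) have c: "c > 0" by simp
  have le: "real_limsup (\<lambda>k. d * u k) \<le> d * real_limsup u" if "d > 0" "Bseq u" for d u
  proof -
    have "real_limsup (\<lambda>k. d * u k) / d \<le> real_limsup u"
    proof (rule dense_ge)
      fix b assume "real_limsup u < b"
      then have "\<forall>\<^sub>F k in sequentially. d * u k \<le> d * b"
        using eventually_le_of_real_limsup_less[OF that(2)] that(1) by (auto elim!: eventually_mono)
      then have "real_limsup (\<lambda>k. d * u k) \<le> d * b"
        using that by (intro real_limsup_le) (simp_all add: Bseq_cmult_iff)
      then show "real_limsup (\<lambda>k. d * u k) / d \<le> b" using that(1) by (simp add: field_simps)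
    qed
    then show ?thesis using that(1) by (simp add: field_simps)
  qed
  have "Bseq (\<lambda>k. c * s k)" using assms(1) False by (simp add: Bseq_cmult_iff)
  from le[OF _ this, of "1/c"] c have "c * real_limsup s \<le> real_limsup (\<lambda>k. c * s k)"
    by (simp add: field_simps)
  with le[OF c assms(1)] show ?thesis by simp
qed

lemma real_limsup_subseq_le:
  assumes "Bseq s" "strict_mono r"
  shows "real_limsup (\<lambda>k. s (r k)) \<le> real_limsup s"
  by (rule real_limsup_mono_eventually[OF Bseq_subseq[OF assms(1), of r] assms(1)])
    (rule eventually_subseq[OF assms(2)])

lemma real_limsup_shift:
  assumes "Bseq s"
  shows "real_limsup (\<lambda>k. s (m + k)) = real_limsup s"
proof (rule antisym)
  show "real_limsup (\<lambda>k. s (m + k)) \<le> real_limsup s"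
    using assms by (intro real_limsup_subseq_le) (auto simp: strict_mono_def)
  show "real_limsup s \<le> real_limsup (\<lambda>k. s (m + k))"
  proof (rule real_limsup_mono_eventually[OF assms])
    show "Bseq (\<lambda>k. s (m + k))" using Bseq_subseq[OF assms, of "\<lambda>k. m + k"] by simp
    show "\<forall>\<^sub>F k in sequentially. s k \<le> c" if "\<forall>\<^sub>F k in sequentially. s (m + k) \<le> c" for c
      using that eventually_sequentially_seg[of "\<lambda>k. s k \<le> c" m] by (simp add: add.commute)
  qed
qed

lemma real_limsup_abs_le:
  assumes "\<And>k. \<bar>s k\<bar> \<le> K"
  shows "\<bar>real_limsup s\<bar> \<le> K"
proof -
  have "- K \<le> s k" "s k \<le> K" for k using assms[of k] by auto
  moreover have "Bseq s" by (rule BseqI'[of _ K]) (use assms in simp)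
  ultimately have "- K \<le> real_limsup s" "real_limsup s \<le> K"
    by (auto intro!: real_limsup_le real_limsup_ge)
  then show ?thesis by simp
qed

lemma subseq_le_minus_limsup_uminus:
  assumes "Bseq s" "e > 0"
  obtains r :: "nat \<Rightarrow> nat" where "strict_mono r" "\<And>k. s (r k) \<le> - real_limsup (\<lambda>k. - s k) + e"
proof -
  have "\<exists>\<^sub>F k in sequentially. s k \<le> - real_limsup (\<lambda>k. - s k) + e"
  proof (rule ccontr)
    assume "\<not> ?thesis"
    then have "\<forall>\<^sub>F k in sequentially. - s k \<le> real_limsup (\<lambda>k. - s k) - e"
      by (auto simp: not_frequently elim!: eventually_mono)
    from real_limsup_le[OF _ this] assms show False by (simp add: Bseq_minus_iff)
  qed
  then have inf: "infinite {k. s k \<le> - real_limsup (\<lambda>k. - s k) + e}"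
    by (simp add: frequently_cofinite flip: cofinite_eq_sequentially)
  show thesis
    by (rule that[OF strict_mono_enumerate[OF inf]]) (use enumerate_in_set[OF inf] in simp)
qed

section \<open>Functionals on a normed space and its bidual\<close>

text \<open>
  The sets where all functionals of \<open>T\<close> are at most \<open>n\<close> in absolute value are
  closed and cover the space, so by Baire's theorem one of them contains a ball.
\<close>

lemma banach_steinhaus_functionals:
  fixes T :: "('a::banach \<Rightarrow>\<^sub>L real) set"
  assumes "\<And>x. \<exists>K. \<forall>f\<in>T. \<bar>f x\<bar> \<le> K"
  obtains C where "\<And>f. f \<in> T \<Longrightarrow> norm f \<le> C"
proof -
  define X where "X n = {x. \<forall>f\<in>T. \<bar>blinfun_apply f x\<bar> \<le> real n}" for n :: nat
  have "closed (X n)" for n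
  proof -
    have "X n = (\<Inter>f\<in>T. {x. \<bar>blinfun_apply f x\<bar> \<le> real n})" by (auto simp: X_def)
    moreover have "closed {x. \<bar>blinfun_apply f x\<bar> \<le> real n}" for f
      by (intro closed_Collect_le continuous_intros)
    ultimately show ?thesis by auto
  qed
  moreover have "(\<Union>n. X n) = UNIV"
  proof -
    have "\<exists>n. x \<in> X n" for x
    proof -
      obtain K where "\<forall>f\<in>T. \<bar>f x\<bar> \<le> K" using assms by blast
      moreover obtain n :: nat where "K \<le> n" using real_arch_simple by blast
      ultimately have "x \<in> X n" by (fastforce simp: X_def)
      then show ?thesis ..
    qed
    then show ?thesis by auto
  qed
  ultimately obtain n where "interior (X n) \<noteq> {}"
    using Baire_category_alt[of "euclidean :: 'a topology" "range X"] completely_metrizable_space_euclidean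
    by auto
  then obtain z e where e: "e > 0" "cball z e \<subseteq> X n"
    by (metis all_not_in_conv mem_interior_cball)
  show thesis
  proof (rule that)
    fix f assume f: "f \<in> T"
    show "norm f \<le> 2 * real n / e"
    proof (rule norm_blinfun_bound)
      show "0 \<le> 2 * real n / e" using e by simp
      fix x
      show "norm (f x) \<le> 2 * real n / e * norm x"
      proof (cases "x = 0")
        case False
        define y where "y = (e / norm x) *\<^sub>R x"
        have "z + y \<in> X n" "z \<in> X n" using e False by (auto simp: y_def dist_norm)
        then have "\<bar>f (z + y)\<bar> \<le> n" "\<bar>f z\<bar> \<le> n" using f by (auto simp: X_def)
        then have "\<bar>f y\<bar> \<le> 2 * n" by (simp add: blinfun.add_right)
        moreover have "f y = e / norm x * f x" by (simp add: y_def blinfun.scaleR_right)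
        ultimately show ?thesis using e False by (simp add: abs_mult field_simps)
      qed simp
    qed
  qed
qed

lemma linear_blinfun_apply: "linear (blinfun_apply f)"
  by (rule bounded_linear.linear[OF blinfun.bounded_linear_right])

lemma linear_bounded_blinfun:
  fixes F :: "'a::real_normed_vector \<Rightarrow> real"
  assumes "linear F" "\<And>x. F x \<le> K * norm x" "K \<ge> 0"
  obtains f :: "'a \<Rightarrow>\<^sub>L real" where "\<And>x. f x = F x" "norm f \<le> K"
proof -
  have abs: "\<bar>F x\<bar> \<le> K * norm x" for x
    using assms(2)[of x] assms(2)[of "- x"] linear_neg[OF assms(1), of x] by simp
  then have "bounded_linear F"
    by (intro bounded_linear_intro[of F K] linear_add linear_cmul assms(1)) (simp add: mult.commute)
  then have ap: "blinfun_apply (Blinfun F) = F" by (rule bounded_linear_Blinfun_apply)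
  then have "norm (Blinfun F) \<le> K" using abs by (intro norm_blinfun_bound[OF assms(3)]) simp
  with that[of "Blinfun F"] ap show thesis by simp
qed

lemma sublinear_norm: "K \<ge> 0 \<Longrightarrow> sublinear (\<lambda>x :: 'a::real_normed_vector. K * norm x)"
  by (auto simp: sublinear_def norm_triangle_ineq simp flip: distrib_left intro!: mult_left_mono)

text \<open>
  By induction on \<open>I\<close>: if \<open>f j\<close> does not vanish on the common kernel of the
  others, subtracting a multiple of \<open>f j\<close> from \<open>g\<close> makes the difference vanish
  there.
\<close>

lemma linear_combination_of_kernels:
  fixes g :: "'a::real_vector \<Rightarrow> real"
  assumes "finite I" "linear g" "\<And>i. i \<in> I \<Longrightarrow> linear (f i)"
    "\<forall>x. (\<forall>i\<in>I. f i x = 0) \<longrightarrow> g x = 0"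
  shows "\<exists>c. \<forall>x. g x = (\<Sum>i\<in>I. c i * f i x)"
  using assms
proof (induction I arbitrary: g rule: finite_induct)
    case empty
    then show ?case by simp
  next
    case (insert j I)
    show ?case
    proof (cases "\<forall>x. (\<forall>i\<in>I. f i x = 0) \<longrightarrow> f j x = 0")
      case True
      with insert.prems(3) have "\<forall>x. (\<forall>i\<in>I. f i x = 0) \<longrightarrow> g x = 0" by blast
      then obtain c where "\<forall>x. g x = (\<Sum>i\<in>I. c i * f i x)"
        using insert.IH[of g] insert.prems(1,2) by auto
      then have "g x = (\<Sum>i\<in>insert j I. (c(j := 0)) i * f i x)" for x
        using insert.hyps by (simp, intro sum.cong) auto
      then show ?thesis by blast
    next
      case False
      then obtain z where z: "\<And>i. i \<in> I \<Longrightarrow> f i z = 0" "f j z \<noteq> 0" by blast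
      define d where "d = g z / f j z"
      have "linear (\<lambda>x. g x - d * f j x)"
        using insert.prems(1) insert.prems(2)[of j] by (auto simp: linear_iff algebra_simps)
      moreover have "\<forall>x. (\<forall>i\<in>I. f i x = 0) \<longrightarrow> g x - d * f j x = 0"
      proof (intro allI impI)
        fix x assume x: "\<forall>i\<in>I. f i x = 0"
        let ?y = "x - (f j x / f j z) *\<^sub>R z"
        have "f i ?y = 0" if "i \<in> insert j I" for i
          using that x z insert.prems(2)[OF that] by (auto simp: linear_diff linear_cmul)
        then have "g ?y = 0" using insert.prems(3) by blast
        then show "g x - d * f j x = 0" using insert.prems(1) by (simp add: d_def linear_diff linear_cmul)
      qed
      ultimately obtain c where c: "\<forall>x. g x - d * f j x = (\<Sum>i\<in>I. c i * f i x)"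
        using insert.IH[of "\<lambda>x. g x - d * f j x"] insert.prems(2) by auto
      have "g x = (\<Sum>i\<in>insert j I. (c(j := d)) i * f i x)" for x
      proof -
        have "(\<Sum>i\<in>I. (c(j := d)) i * f i x) = (\<Sum>i\<in>I. c i * f i x)"
          using insert.hyps by (intro sum.cong) auto
        then show ?thesis using c insert.hyps by (simp add: algebra_simps)
      qed
      then show ?thesis by blast
    qed
  qed

text \<open>
  A functional that depends linearly on the previous ones is interpolated automatically, since
  \<open>Phi\<close> respects the dependence; an independent one can be adjusted along a common zero of
  the others.
\<close>

lemma interpolate_functionals:
  fixes Phi :: "('a::real_normed_vector \<Rightarrow>\<^sub>L real) \<Rightarrow>\<^sub>L real"
  assumes "finite G"
  obtains x where "\<And>g. g \<in> G \<Longrightarrow> blinfun_apply g x = Phi g"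
proof -
  have "\<exists>x. \<forall>g\<in>G. blinfun_apply g x = Phi g"
    using assms
  proof (induction G rule: finite_induct)
    case (insert h G)
    then obtain x where x: "\<forall>g\<in>G. blinfun_apply g x = Phi g" by blast
    show ?case
    proof (cases "\<forall>z. (\<forall>g\<in>G. blinfun_apply g z = 0) \<longrightarrow> h z = 0")
      case True
      from linear_combination_of_kernels[OF insert.hyps(1) linear_blinfun_apply linear_blinfun_apply True]
      obtain c where c: "\<And>y. h y = (\<Sum>g\<in>G. c g * blinfun_apply g y)" by blast
      then have "h = (\<Sum>g\<in>G. c g *\<^sub>R g)"
        by (intro blinfun_eqI) (simp add: blinfun.sum_left blinfun.scaleR_left)
      then have "Phi h = (\<Sum>g\<in>G. c g * Phi g)"
        by (simp add: blinfun.sum_right blinfun.scaleR_right)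
      with c x have "h x = Phi h" by simp
      with x show ?thesis by blast
    next
      case False
      then obtain z where z: "\<And>g. g \<in> G \<Longrightarrow> blinfun_apply g z = 0" "h z \<noteq> 0" by blast
      let ?y = "x + ((Phi h - h x) / h z) *\<^sub>R z"
      have "\<forall>g\<in>insert h G. blinfun_apply g ?y = Phi g"
        using x z by (simp add: blinfun.add_right blinfun.scaleR_right)
      then show ?thesis by blast
    qed
  qed simp
  then show thesis using that by blast
qed

lemma sublinear_infdist:
  fixes S :: "'a::real_normed_vector set"
  assumes S: "subspace S"
  shows "sublinear (\<lambda>x. infdist x S)"
proof -
  have ne: "S \<noteq> {}" using subspace_0[OF S] by auto
  have near: "\<exists>k\<in>S. norm (x - k) < infdist x S + e" if "e > 0" for x e
  proof -
    have "infdist x S < infdist x S + e" using that by simp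
    then show ?thesis using ne unfolding infdist_notempty[OF ne]
      by (subst (asm) cINF_less_iff) (auto simp: dist_norm intro: bdd_belowI[of _ 0])
  qed
  have le: "infdist x S \<le> norm (x - k)" if "k \<in> S" for x k
    using infdist_le[OF that, of x] by (simp add: dist_norm)
  have scale_le: "infdist (t *\<^sub>R x) S \<le> t * infdist x S" if t: "t > 0" for t x
  proof (rule field_le_epsilon)
    fix e :: real assume "e > 0"
    then obtain k where k: "k \<in> S" "norm (x - k) < infdist x S + e / t" using near[of "e/t" x] t by auto
    have "infdist (t *\<^sub>R x) S \<le> norm (t *\<^sub>R x - t *\<^sub>R k)" by (rule le) (rule subspace_scale[OF S k(1)])
    also have "\<dots> = t * norm (x - k)" using t by (simp flip: scaleR_diff_right)
    also have "\<dots> \<le> t * (infdist x S + e / t)" using k t by (intro mult_left_mono) auto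
    also have "\<dots> = t * infdist x S + e" using t by (simp add: distrib_left)
    finally show "infdist (t *\<^sub>R x) S \<le> t * infdist x S + e" .
  qed
  show ?thesis
    unfolding sublinear_def
  proof (intro conjI allI impI)
    fix x y
    show "infdist (x + y) S \<le> infdist x S + infdist y S"
    proof (rule field_le_epsilon)
      fix e :: real assume "e > 0"
      then obtain k l where k: "k \<in> S" "norm (x - k) < infdist x S + e / 2"
        and l: "l \<in> S" "norm (y - l) < infdist y S + e / 2" using near[of "e/2" x] near[of "e/2" y] by auto
      have "infdist (x + y) S \<le> norm (x + y - (k + l))" by (rule le) (rule subspace_add[OF S k(1) l(1)])
      also have "\<dots> \<le> norm (x - k) + norm (y - l)" by (metis add_diff_add norm_triangle_ineq)
      finally show "infdist (x + y) S \<le> infdist x S + infdist y S + e" using k l by linarith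
    qed
  next
    fix t :: real and x :: 'a assume "t \<ge> 0"
    show "infdist (t *\<^sub>R x) S = t * infdist x S"
    proof (cases "t = 0")
      case False
      with \<open>t \<ge> 0\<close> have t: "t > 0" by simp
      have "infdist ((1/t) *\<^sub>R (t *\<^sub>R x)) S \<le> 1/t * infdist (t *\<^sub>R x) S"
        by (rule scale_le) (use t in simp)
      then have "t * infdist x S \<le> infdist (t *\<^sub>R x) S" using t by (simp add: field_simps)
      with scale_le[OF t, of x] show ?thesis by simp
    qed (use subspace_0[OF S] in simp)
  qed
qed

text \<open>
  The solutions of the interpolation problem form a coset of the common kernel \<open>S\<close>, so the
  infimum of their norms is the distance of any solution \<open>x\<close> to \<open>S\<close>. This
  distance is the value at \<open>x\<close> of a functional of norm at most one that vanishes on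
  \<open>S\<close>, hence is a combination of \<open>G\<close>, and \<open>Phi\<close> takes the same
  value on it.
\<close>

lemma helly:
  fixes Phi :: "('a::real_normed_vector \<Rightarrow>\<^sub>L real) \<Rightarrow>\<^sub>L real"
  assumes G: "finite G"
  obtains x where "\<And>g. g \<in> G \<Longrightarrow> blinfun_apply g x = Phi g" "norm x \<le> norm Phi + 1"
proof -
  obtain x where x: "\<And>g. g \<in> G \<Longrightarrow> blinfun_apply g x = Phi g" using interpolate_functionals[OF G] by blast
  define S where "S = {z. \<forall>g\<in>G. blinfun_apply g z = 0}"
  have S: "subspace S"
    by (auto simp: S_def subspace_def blinfun.add_right blinfun.scaleR_right)
  have "0 \<in> S" using subspace_0[OF S] .
  obtain F where F: "linear F" "\<And>y. F y \<le> infdist y S" "F x = infdist x S"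
    using hahn_banach_support[OF sublinear_infdist[OF S]] by blast
  have "F y \<le> 1 * norm y" for y using F(2)[of y] infdist_le[OF \<open>0 \<in> S\<close>, of y] by simp
  from linear_bounded_blinfun[OF F(1) this] obtain f where f: "\<And>y. blinfun_apply f y = F y" "norm f \<le> 1" by auto
  have "F z = 0" if "z \<in> S" for z
    using F(2)[of z] F(2)[of "- z"] linear_neg[OF F(1), of z] that subspace_neg[OF S that] by simp
  then have "\<forall>z. (\<forall>g\<in>G. blinfun_apply g z = 0) \<longrightarrow> F z = 0" by (simp add: S_def)
  from linear_combination_of_kernels[OF G F(1) linear_blinfun_apply this]
  obtain c where c: "\<And>y. F y = (\<Sum>g\<in>G. c g * blinfun_apply g y)" by blast
  then have "f = (\<Sum>g\<in>G. c g *\<^sub>R g)"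
    by (intro blinfun_eqI) (simp add: f blinfun.sum_left blinfun.scaleR_left)
  then have "Phi f = (\<Sum>g\<in>G. c g * Phi g)" by (simp add: blinfun.sum_right blinfun.scaleR_right)
  also have "\<dots> = F x" by (simp add: c x)
  finally have "infdist x S = Phi f" using F(3) by simp
  also have "\<dots> \<le> norm Phi * norm f" using norm_blinfun[of Phi f] by (simp add: abs_le_D1)
  also have "\<dots> \<le> norm Phi" using f(2) by (simp add: mult_left_le)
  finally have "infdist x S < norm Phi + 1" by simp
  moreover have ne: "S \<noteq> {}" using \<open>0 \<in> S\<close> by auto
  ultimately obtain k where k: "k \<in> S" "dist x k < norm Phi + 1"
    unfolding infdist_notempty[OF ne]
    by (subst (asm) cINF_less_iff) (auto intro: bdd_belowI[of _ 0])
  show thesis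
    by (rule that[of "x - k"]) (use k x in \<open>auto simp: S_def dist_norm blinfun.diff_right\<close>)
qed

lemma norming_functional:
  fixes x :: "'a::real_normed_vector"
  obtains f :: "'a \<Rightarrow>\<^sub>L real" where "norm f \<le> 1" "f x = norm x"
proof -
  have "sublinear (\<lambda>x :: 'a. 1 * norm x)" by (rule sublinear_norm) simp
  then obtain F where F: "linear F" "\<And>y. F y \<le> 1 * norm y" "F x = 1 * norm x"
    by (rule hahn_banach_support[where z = x]) blast
  from linear_bounded_blinfun[OF F(1,2)] obtain f :: "'a \<Rightarrow>\<^sub>L real"
    where "\<And>x. f x = F x" "norm f \<le> 1" by auto
  with F(3) that show thesis by simp
qed

text \<open>
  Completeness enters here: \<open>X\<close> is closed in its bidual, so a \<open>Phi\<close> outside it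
  has positive distance.
\<close>

lemma bidual_gap:
  fixes Phi :: "('a::banach \<Rightarrow>\<^sub>L real) \<Rightarrow>\<^sub>L real"
  assumes "\<nexists>x. \<forall>f. Phi f = blinfun_apply f x"
  shows "\<exists>\<theta>>0. \<forall>x. \<exists>f. \<theta> * norm f < \<bar>Phi f - blinfun_apply f x\<bar>"
proof (rule ccontr)
  assume "\<not> ?thesis"
  then have "\<forall>\<theta>>0. \<exists>x. \<forall>f. \<bar>Phi f - blinfun_apply f x\<bar> \<le> \<theta> * norm f"
    by (meson not_less)
  then have "\<forall>n. \<exists>x. \<forall>f. \<bar>Phi f - blinfun_apply f x\<bar> \<le> inverse (real (Suc n)) * norm f" by simp
  then obtain x where "\<forall>n. \<forall>f. \<bar>Phi f - blinfun_apply f (x n)\<bar> \<le> inverse (real (Suc n)) * norm f"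
    by (rule choice[THEN exE])
  then have x: "\<bar>Phi f - blinfun_apply f (x n)\<bar> \<le> inverse (real (Suc n)) * norm f" for n f by blast
  have dist: "dist (x m) (x n) \<le> inverse (real (Suc m)) + inverse (real (Suc n))" for m n
  proof -
    obtain f :: "'a \<Rightarrow>\<^sub>L real" where f: "norm f \<le> 1" "f (x m - x n) = norm (x m - x n)"
      using norming_functional by blast
    have "\<bar>Phi f - f (x k)\<bar> \<le> inverse (real (Suc k))" for k
      by (rule order_trans[OF x mult_left_le[OF f(1)]]) simp
    from this[of m] this[of n] f(2) show ?thesis by (simp add: dist_norm blinfun.diff_right)
  qed
  have inv: "(\<lambda>n. inverse (real (Suc n))) \<longlonglongrightarrow> 0" by (rule LIMSEQ_inverse_real_of_nat)
  have "Cauchy x"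
  proof (rule metric_CauchyI)
    fix e :: real assume e: "e > 0"
    then obtain N where N: "\<And>n. n \<ge> N \<Longrightarrow> inverse (real (Suc n)) < e / 2"
      using order_tendstoD(2)[OF inv, of "e/2"] by (auto simp: eventually_sequentially)
    show "\<exists>N. \<forall>m\<ge>N. \<forall>n\<ge>N. dist (x m) (x n) < e"
    proof (intro exI allI impI)
      fix m n assume "N \<le> m" "N \<le> n"
      then show "dist (x m) (x n) < e" using dist[of m n] N[of m] N[of n] by linarith
    qed
  qed
  then obtain l where l: "x \<longlonglongrightarrow> l" using Cauchy_convergent convergent_def by blast
  have "Phi f = f l" for f
  proof -
    have "(\<lambda>n. \<bar>Phi f - f (x n)\<bar>) \<longlonglongrightarrow> \<bar>Phi f - f l\<bar>" by (intro tendsto_intros l)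
    moreover have "(\<lambda>n. inverse (real (Suc n)) * norm f) \<longlonglongrightarrow> 0 * norm f" by (intro tendsto_intros inv)
    ultimately have "\<bar>Phi f - f l\<bar> \<le> 0 * norm f" using x by (intro LIMSEQ_le) auto
    then show ?thesis by simp
  qed
  with assms show False by blast
qed

text \<open>
  Otherwise \<open>Phi\<close> has norm at most \<open>\<theta>\<close> on the annihilator of
  \<open>E\<close>. A Hahn-Banach extension \<open>\<psi>\<close> of this restriction with the same
  bound differs from \<open>Phi\<close> by a functional vanishing on the annihilator, that is, by
  evaluation at a vector in the span of \<open>E\<close>, which contradicts the gap.
\<close>

lemma large_functional_vanishing_on_finite:
  fixes Phi :: "('a::real_normed_vector \<Rightarrow>\<^sub>L real) \<Rightarrow>\<^sub>L real"
  assumes gap: "\<theta> > 0" "\<And>x. \<exists>f. \<theta> * norm f < \<bar>Phi f - blinfun_apply f x\<bar>" and E: "finite E"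
  shows "\<exists>f. norm f \<le> 1 \<and> (\<forall>x\<in>E. blinfun_apply f x = 0) \<and> \<theta> \<le> Phi f"
proof (rule ccontr)
  assume "\<not> ?thesis"
  then have small: "Phi f < \<theta>" if "norm f \<le> 1" "\<forall>x\<in>E. blinfun_apply f x = 0"
    for f :: "'a \<Rightarrow>\<^sub>L real"
    using that not_le by blast
  define S where "S = {f :: 'a \<Rightarrow>\<^sub>L real. \<forall>x\<in>E. blinfun_apply f x = 0}"
  have S: "subspace S"
    by (auto simp: S_def subspace_def blinfun.add_left blinfun.scaleR_left)
  have le: "Phi f \<le> \<theta> * norm f" if "f \<in> S" for f
  proof (cases "f = 0")
    case False
    have "Phi ((1 / norm f) *\<^sub>R f) < \<theta>"
      by (rule small) (use that False in \<open>auto simp: S_def blinfun.scaleR_left\<close>)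
    then show ?thesis using False by (simp add: blinfun.scaleR_right field_simps)
  qed simp
  have "0 \<le> \<theta>" using gap(1) by simp
  from hahn_banach_subspace[OF sublinear_norm[OF this] S linear_blinfun_apply le]
  obtain \<psi> where \<psi>: "linear \<psi>" "\<And>f. \<psi> f \<le> \<theta> * norm f" "\<And>f. f \<in> S \<Longrightarrow> \<psi> f = Phi f" by blast
  have "linear (\<lambda>f. Phi f - \<psi> f)"
    using \<psi>(1) linear_blinfun_apply[of Phi] by (simp add: linear_compose_sub)
  moreover have "linear (\<lambda>f. blinfun_apply f x)" for x :: 'a
    by (simp add: linear_iff blinfun.add_left blinfun.scaleR_left)
  moreover have "\<forall>f. (\<forall>x\<in>E. blinfun_apply f x = 0) \<longrightarrow> Phi f - \<psi> f = 0"
    using \<psi>(3) by (simp add: S_def)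
  ultimately obtain c where c: "\<And>f. Phi f - \<psi> f = (\<Sum>x\<in>E. c x * blinfun_apply f x)"
    using linear_combination_of_kernels[OF E, of "\<lambda>f. Phi f - \<psi> f" "\<lambda>x f. blinfun_apply f x"] by blast
  have "\<bar>\<psi> f\<bar> \<le> \<theta> * norm f" for f
    using \<psi>(2)[of f] \<psi>(2)[of "- f"] linear_neg[OF \<psi>(1), of f] by simp
  moreover have "Phi f - blinfun_apply f (\<Sum>x\<in>E. c x *\<^sub>R x) = \<psi> f" for f
    using c[of f] by (simp add: blinfun.sum_right blinfun.scaleR_right)
  ultimately show False using gap(2)[of "\<Sum>x\<in>E. c x *\<^sub>R x"] by (simp add: not_le[symmetric])
qed

text \<open>
  The \<open>f n\<close> and \<open>x n\<close> are chosen alternately: \<open>f n\<close> vanishes on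
  \<open>Y\<close> and on all earlier \<open>x m\<close> but has \<open>Phi (f n) \<ge>
  \<theta>\<close>, and \<open>x n\<close> imitates \<open>Phi\<close> on the functionals chosen up to
  then.
\<close>

lemma nonreflexive_sequences:
  fixes Phi :: "('a::banach \<Rightarrow>\<^sub>L real) \<Rightarrow>\<^sub>L real"
  assumes Phi: "\<nexists>x. \<forall>f. Phi f = blinfun_apply f x" and Y: "finite Y"
  obtains f :: "nat \<Rightarrow> 'a \<Rightarrow>\<^sub>L real" and x \<theta> M where "\<theta> > 0"
    "\<And>n. norm (f n) \<le> 1" "\<And>n y. y \<in> Y \<Longrightarrow> f n y = 0" "\<And>m. norm (x m) \<le> M"
    "\<And>m n. m < n \<Longrightarrow> f n (x m) = 0" "\<And>m n. n \<le> m \<Longrightarrow> \<theta> \<le> f n (x m)"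
proof -
  obtain \<theta> where \<theta>: "\<theta> > 0" "\<And>x. \<exists>f. \<theta> * norm f < \<bar>Phi f - blinfun_apply f x\<bar>"
    using bidual_gap[OF Phi] by blast
  (* The state collects the vectors E and the functionals G chosen so far, and the newest f and x. *)
  define P where "P = (\<lambda>(n::nat) (E, G, f, x). finite E \<and> finite G \<and> Y \<subseteq> E \<and> f \<in> G \<and> x \<in> E \<and>
    norm f \<le> 1 \<and> (\<forall>y\<in>Y. blinfun_apply f y = 0) \<and> norm x \<le> norm Phi + 1 \<and>
    \<theta> \<le> Phi f \<and> (\<forall>g\<in>G. blinfun_apply g x = Phi g))"
  define Q where "Q = (\<lambda>(n::nat) (E, G, f :: 'a \<Rightarrow>\<^sub>L real, x :: 'a) (E' :: 'a set, G' :: ('a \<Rightarrow>\<^sub>L real) set, f' :: 'a \<Rightarrow>\<^sub>L real, x' :: 'a).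
    E \<subseteq> E' \<and> G \<subseteq> G' \<and> (\<forall>e\<in>E. blinfun_apply f' e = 0))"
  have step: "\<exists>f x. P n (insert x E, insert f G, f, x) \<and> (\<forall>e\<in>E. blinfun_apply f e = 0)"
    if fin: "finite E" "finite G" "Y \<subseteq> E" for n E G
  proof -
    obtain f where f: "norm f \<le> 1" "\<And>x. x \<in> E \<Longrightarrow> blinfun_apply f x = 0" "\<theta> \<le> Phi f"
      using large_functional_vanishing_on_finite[OF \<theta> fin(1)] by blast
    have "finite (insert f G)" using fin by simp
    from helly[OF this, of Phi] obtain x where
      "\<And>g. g \<in> insert f G \<Longrightarrow> blinfun_apply g x = Phi g" "norm x \<le> norm Phi + 1" by blast
    with f fin show ?thesis by (intro exI[of _ f] exI[of _ x]) (auto simp: P_def)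
  qed
  have "\<exists>s. \<forall>n. P n (s n) \<and> Q n (s n) (s (Suc n))"
  proof (rule dependent_nat_choice)
    show "\<exists>s. P 0 s" using step[OF Y, of "{}"] by blast
    fix s n assume P: "P n s"
    obtain E G f x where s: "s = (E, G, f, x)" by (cases s)
    with P have "finite E" "finite G" "Y \<subseteq> E" by (auto simp: P_def)
    from step[OF this, of "Suc n"] obtain f' x' where
      "P (Suc n) (insert x' E, insert f' G, f', x')" "\<forall>e\<in>E. blinfun_apply f' e = 0" by blast
    then show "\<exists>s'. P (Suc n) s' \<and> Q n s s'"
      by (intro exI[of _ "(insert x' E, insert f' G, f', x')"]) (auto simp: Q_def s)
  qed
  then obtain s where s: "\<And>n. P n (s n)" "\<And>n. Q n (s n) (s (Suc n))" by blast
  define E G f x where "E n = fst (s n)" and "G n = fst (snd (s n))"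
    and "f n = fst (snd (snd (s n)))" and "x n = snd (snd (snd (s n)))" for n
  note defs = E_def G_def f_def x_def
  have P: "f n \<in> G n \<and> x n \<in> E n \<and> norm (f n) \<le> 1 \<and> (\<forall>y\<in>Y. blinfun_apply (f n) y = 0) \<and>
      norm (x n) \<le> norm Phi + 1 \<and> \<theta> \<le> Phi (f n) \<and> (\<forall>g\<in>G n. blinfun_apply g (x n) = Phi g)" for n
    using s(1)[of n] by (auto simp: P_def defs split_beta)
  have Q: "E n \<subseteq> E (Suc n) \<and> G n \<subseteq> G (Suc n) \<and> (\<forall>e\<in>E n. blinfun_apply (f (Suc n)) e = 0)" for n
    using s(2)[of n] by (auto simp: Q_def defs split_beta)
  have E: "E m \<subseteq> E n" and G: "G m \<subseteq> G n" if "m \<le> n" for m n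
    using lift_Suc_mono_le[of E m n] lift_Suc_mono_le[of G m n] Q that by auto
  show thesis
  proof (rule that[OF \<theta>(1)])
    show "f n (x m) = 0" if mn: "m < n" for m n
    proof -
      from mn obtain k where "n = Suc k" "m \<le> k" by (cases n) auto
      then show ?thesis using P[of m] Q[of k] E[of m k] by blast
    qed
    show "\<theta> \<le> f n (x m)" if "n \<le> m" for m n
    proof -
      have "f n (x m) = Phi (f n)" using P[of m] P[of n] G[OF that] by blast
      then show ?thesis using P[of n] by simp
    qed
  qed (use P in auto)
qed

section \<open>Pryce's subsequence\<close>

text \<open>
  Rational combinations of \<open>S\<close>, written as lists of coefficients and vectors so that
  countability is immediate.
\<close>

lemma countable_dense_in_span:
  fixes S :: "'a::real_normed_vector set"
  assumes "countable S"
  obtains D where "countable D" "D \<noteq> {}" "span S \<subseteq> closure D"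
proof
  define D where "D = (\<lambda>L. \<Sum>(q, v)\<leftarrow>L. real_of_rat q *\<^sub>R v) ` lists (UNIV \<times> S)"
  have "countable ((UNIV :: rat set) \<times> S)" using assms by simp
  then show "countable D" unfolding D_def by (intro countable_image countable_lists)
  have zero: "0 \<in> D" unfolding D_def by (rule image_eqI[of _ _ "[]"]) auto
  then show "D \<noteq> {}" by auto
  have add: "u + v \<in> D" if "u \<in> D" "v \<in> D" for u v
  proof -
    from that obtain L M where "L \<in> lists (UNIV \<times> S)" "M \<in> lists (UNIV \<times> S)"
      "u = (\<Sum>(q, v)\<leftarrow>L. real_of_rat q *\<^sub>R v)" "v = (\<Sum>(q, v)\<leftarrow>M. real_of_rat q *\<^sub>R v)"
      by (auto simp: D_def)
    then show ?thesis unfolding D_def by (intro image_eqI[of _ _ "L @ M"]) auto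
  qed
  have scale_rat: "real_of_rat q *\<^sub>R v \<in> D" if "v \<in> D" for q v
  proof -
    from that obtain L where L: "L \<in> lists (UNIV \<times> S)" "v = (\<Sum>(q, v)\<leftarrow>L. real_of_rat q *\<^sub>R v)"
      by (auto simp: D_def)
    have "real_of_rat q *\<^sub>R (\<Sum>(q, v)\<leftarrow>L. real_of_rat q *\<^sub>R v) =
        (\<Sum>(q, v)\<leftarrow>map (\<lambda>(p, v). (q * p, v)) L. real_of_rat q *\<^sub>R v)"
      by (induction L) (auto simp: of_rat_mult scaleR_right_distrib)
    then show ?thesis
      using L unfolding D_def by (intro image_eqI[of _ _ "map (\<lambda>(p, v). (q * p, v)) L"]) auto
  qed
  have "subspace (closure D)"
    unfolding subspace_def
  proof (intro conjI ballI allI)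
    show "0 \<in> closure D" using zero closure_subset by auto
  next
    fix u v assume "u \<in> closure D" "v \<in> closure D"
    then obtain U V where "\<And>n. U n \<in> D" "U \<longlonglongrightarrow> u" "\<And>n. V n \<in> D" "V \<longlonglongrightarrow> v"
      by (auto simp: closure_sequential)
    then show "u + v \<in> closure D"
      unfolding closure_sequential by (intro exI[of _ "\<lambda>n. U n + V n"]) (auto intro: add tendsto_add)
  next
    fix c :: real and v assume "v \<in> closure D"
    then obtain V where V: "\<And>n. V n \<in> D" "V \<longlonglongrightarrow> v" by (auto simp: closure_sequential)
    have "c \<in> closure \<rat>" by (simp add: Rats_closure_real)
    then obtain q where q: "\<And>n. q n \<in> \<rat>" "q \<longlonglongrightarrow> c" by (auto simp: closure_sequential)
    have "q n *\<^sub>R V n \<in> D" for n using q(1)[of n] scale_rat[OF V(1)] by (auto elim: Rats_cases)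
    then show "c *\<^sub>R v \<in> closure D"
      unfolding closure_sequential using V q
      by (intro exI[of _ "\<lambda>n. q n *\<^sub>R V n"]) (auto intro: tendsto_scaleR)
  qed
  moreover have "S \<subseteq> closure D"
  proof
    fix v assume v: "v \<in> S"
    have "v \<in> D" unfolding D_def by (rule image_eqI[of _ _ "[(1, v)]"]) (use v in auto)
    then show "v \<in> closure D" using closure_subset by blast
  qed
  ultimately show "span S \<subseteq> closure D" by (rule span_minimal[rotated])
qed

text \<open>
  Written pointwise, this is the inequality \<open>sup\<^sub>B (h - liminf f) \<le> sup\<^sub>B (h - limsup f) + e\<close>. The opposite
  inequality between the two suprema always holds, so for all \<open>e > 0\<close> together it says that they agree.
\<close>

definition limits_agree :: "'a set \<Rightarrow> (nat \<Rightarrow> 'a \<Rightarrow> real) \<Rightarrow> ('a \<Rightarrow> real) \<Rightarrow> real \<Rightarrow> bool" where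
  "limits_agree B f h e \<longleftrightarrow> (\<forall>x\<in>B. \<exists>y\<in>B.
     h x + real_limsup (\<lambda>k. - f k x) \<le> h y - real_limsup (\<lambda>k. f k y) + e)"

text \<open>
  Passing to a subsequence lowers upper limits and raises lower limits, so both sides of the inequality
  move in the favourable direction. This is what makes the diagonal argument work.
\<close>

lemma limits_agree_subseq:
  assumes B: "\<And>x. x \<in> B \<Longrightarrow> Bseq (\<lambda>k. f k x)" and ag: "limits_agree B f h e" and r: "strict_mono r"
  shows "limits_agree B (\<lambda>k. f (r k)) h e"
  unfolding limits_agree_def
proof
  fix x assume x: "x \<in> B"
  then obtain y where y: "y \<in> B"
    "h x + real_limsup (\<lambda>k. - f k x) \<le> h y - real_limsup (\<lambda>k. f k y) + e"
    using ag by (auto simp: limits_agree_def)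
  moreover have "real_limsup (\<lambda>k. - f (r k) x) \<le> real_limsup (\<lambda>k. - f k x)"
    by (rule real_limsup_subseq_le[OF _ r]) (use B[OF x] in \<open>simp add: Bseq_minus_iff\<close>)
  moreover have "real_limsup (\<lambda>k. f (r k) y) \<le> real_limsup (\<lambda>k. f k y)"
    by (rule real_limsup_subseq_le[OF B[OF y(1)] r])
  ultimately show "\<exists>y\<in>B. h x + real_limsup (\<lambda>k. - f (r k) x) \<le> h y - real_limsup (\<lambda>k. f (r k) y) + e"
    by (intro bexI[OF _ y(1)]) linarith
qed

lemma limits_agree_shift:
  assumes B: "\<And>x. x \<in> B \<Longrightarrow> Bseq (\<lambda>k. f k x)" and ag: "limits_agree B (\<lambda>k. f (m + k)) h e"
  shows "limits_agree B f h e"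
proof -
  have "real_limsup (\<lambda>k. f (m + k) x) = real_limsup (\<lambda>k. f k x)"
    "real_limsup (\<lambda>k. - f (m + k) x) = real_limsup (\<lambda>k. - f k x)" if "x \<in> B" for x
    using real_limsup_shift[OF B[OF that], of m] real_limsup_shift[of "\<lambda>k. - f k x" m] B[OF that]
    by (simp_all add: Bseq_minus_iff)
  then show ?thesis using ag by (auto simp: limits_agree_def)
qed

text \<open>
  Take \<open>y\<close> almost maximizing \<open>h - liminf f\<close> and a subsequence along which
  \<open>f k y\<close> stays near its lower limit: for it, the upper limit at \<open>y\<close> is about
  the lower limit.
\<close>

lemma exists_subseq_limits_agree:
  assumes B: "\<And>x k. x \<in> B \<Longrightarrow> \<bar>f k x\<bar> \<le> K" "\<And>x. x \<in> B \<Longrightarrow> h x \<le> H" and e: "e > 0"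
  shows "\<exists>r :: nat \<Rightarrow> nat. strict_mono r \<and> limits_agree B (\<lambda>k. f (r k)) h e"
proof (cases "B = {}")
  case True
  then show ?thesis by (auto simp: limits_agree_def intro: exI[of _ id] strict_mono_id)
next
  case False
  have bseq: "Bseq (\<lambda>k. f k x)" if "x \<in> B" for x by (rule BseqI'[of _ K]) (use B that in auto)
  define T where "T x = h x + real_limsup (\<lambda>k. - f k x)" for x
  have "T x \<le> H + K" if "x \<in> B" for x
    using real_limsup_abs_le[of "\<lambda>k. - f k x" K] B(1)[OF that] B(2)[OF that] unfolding T_def by simp
  then have bdd: "bdd_above (T ` B)" by (intro bdd_aboveI[of _ "H + K"]) auto
  obtain y where y: "y \<in> B" "(SUP x\<in>B. T x) - e / 2 < T y"
    using less_cSUP_iff[OF False bdd, of "(SUP x\<in>B. T x) - e / 2"] e by auto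
  obtain r :: "nat \<Rightarrow> nat" where r: "strict_mono r"
    "\<And>k. f (r k) y \<le> - real_limsup (\<lambda>k. - f k y) + e / 2"
    using subseq_le_minus_limsup_uminus[OF bseq[OF y(1)], of "e/2"] e by auto
  have lim_y: "real_limsup (\<lambda>k. f (r k) y) \<le> - real_limsup (\<lambda>k. - f k y) + e / 2"
    by (rule real_limsup_le) (use Bseq_subseq[OF bseq[OF y(1)]] r in auto)
  have "h x + real_limsup (\<lambda>k. - f (r k) x) \<le> h y - real_limsup (\<lambda>k. f (r k) y) + e" if x: "x \<in> B" for x
  proof -
    have "real_limsup (\<lambda>k. - f (r k) x) \<le> real_limsup (\<lambda>k. - f k x)"
      by (rule real_limsup_subseq_le[OF _ r(1)]) (use bseq[OF x] in \<open>simp add: Bseq_minus_iff\<close>)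
    then have "h x + real_limsup (\<lambda>k. - f (r k) x) \<le> T x" by (simp add: T_def)
    also have "T x \<le> (SUP x\<in>B. T x)" by (rule cSUP_upper[OF x bdd])
    finally show ?thesis using y(2) lim_y unfolding T_def by linarith
  qed
  with r(1) y(1) show ?thesis by (auto simp: limits_agree_def)
qed

lemma exists_subseq_limits_agree_countable:
  assumes B: "\<And>x k. x \<in> B \<Longrightarrow> \<bar>f k x\<bar> \<le> K"
    and D: "countable D" "\<And>h. h \<in> D \<Longrightarrow> \<exists>H. \<forall>x\<in>B. h x \<le> H"
  obtains r :: "nat \<Rightarrow> nat" where "strict_mono r"
    "\<And>h e. h \<in> D \<Longrightarrow> e > 0 \<Longrightarrow> limits_agree B (\<lambda>k. f (r k)) h e"
proof (cases "D = {}")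
  case False
  have bseq: "Bseq (\<lambda>k. f (r k) x)" if "x \<in> B" for x and r :: "nat \<Rightarrow> nat"
    by (rule BseqI'[of _ K]) (use B that in auto)
  define P where "P n r \<longleftrightarrow> limits_agree B (\<lambda>k. f (r k))
    (from_nat_into D (fst (prod_decode n))) (inverse (real (Suc (snd (prod_decode n)))))" for n r
  interpret subseqs P
  proof
    fix n and s :: "nat \<Rightarrow> nat"
    let ?h = "from_nat_into D (fst (prod_decode n))" and ?e = "inverse (real (Suc (snd (prod_decode n))))"
    obtain H where "\<And>x. x \<in> B \<Longrightarrow> ?h x \<le> H" using D(2)[OF from_nat_into[OF False]] by blast
    with exists_subseq_limits_agree[of B "\<lambda>k. f (s k)" K ?h H ?e] B
    show "\<exists>r'. strict_mono r' \<and> P n (s \<circ> r')" by (simp add: P_def)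
  qed
  have "P n (s \<circ> r)" if "strict_mono r" "P n s" for r s n
    using limits_agree_subseq[of B "\<lambda>k. f (s k)", OF bseq _ that(1)] that(2) by (simp add: P_def)
  from diagseq_holds[OF this] have "P n (diagseq \<circ> ((+) (Suc n)))" for n by blast
  then have P: "P n diagseq" for n
    using limits_agree_shift[of B "\<lambda>k. f (diagseq k)" "Suc n", OF bseq]
    by (simp add: P_def del: add_Suc)
  show thesis
  proof (rule that[OF subseq_diagseq])
    fix h and e :: real assume h: "h \<in> D" and e: "e > 0"
    obtain i where i: "from_nat_into D i = h" using from_nat_into_surj[OF D(1) h] by blast
    obtain j where j: "inverse (real (Suc j)) < e" using reals_Archimedean[OF e] by blast
    have "limits_agree B (\<lambda>k. f (diagseq k)) h (inverse (real (Suc j)))"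
      using P[of "prod_encode (i, j)"] by (simp add: P_def i)
    then show "limits_agree B (\<lambda>k. f (diagseq k)) h e"
      unfolding limits_agree_def using j by (meson add_left_mono less_imp_le order_trans)
  qed
qed (use that[OF strict_mono_id] in auto)

text \<open>
  Diagonalization handles a countable dense set of \<open>h\<close>. Both suprema are Lipschitz in
  \<open>h\<close> for the uniform norm on \<open>B\<close>, which extends the agreement to the closure.
\<close>

lemma pryce:
  fixes f :: "nat \<Rightarrow> 'a::real_normed_vector \<Rightarrow>\<^sub>L real" and S :: "('a \<Rightarrow>\<^sub>L real) set"
  assumes f: "\<And>k. norm (f k) \<le> K" and B: "\<And>x. x \<in> B \<Longrightarrow> norm x \<le> R" and S: "countable S"
  obtains r :: "nat \<Rightarrow> nat" where "strict_mono r"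
    "\<And>h e. h \<in> span S \<Longrightarrow> e > 0 \<Longrightarrow> limits_agree B (\<lambda>k. blinfun_apply (f (r k))) (blinfun_apply h) e"
proof -
  have bound: "\<bar>blinfun_apply g x\<bar> \<le> norm g * max R 0" if "x \<in> B" for g :: "'a \<Rightarrow>\<^sub>L real" and x
  proof -
    have "\<bar>g x\<bar> \<le> norm g * norm x" using norm_blinfun[of g x] by simp
    also have "\<dots> \<le> norm g * max R 0" using B[OF that] by (intro mult_left_mono) auto
    finally show ?thesis .
  qed
  obtain D where D: "countable D" "D \<noteq> {}" "span S \<subseteq> closure D" using countable_dense_in_span[OF S] by blast
  have fB: "\<bar>blinfun_apply (f k) x\<bar> \<le> K * max R 0" if "x \<in> B" for x k
    using bound[OF that, of "f k"] mult_right_mono[OF f[of k], of "max R 0"] by simp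
  have DB: "\<exists>H. \<forall>x\<in>B. h x \<le> H" if "h \<in> blinfun_apply ` D" for h
    using that bound abs_le_D1 by blast
  obtain r :: "nat \<Rightarrow> nat" where r: "strict_mono r"
    "\<And>h e. h \<in> blinfun_apply ` D \<Longrightarrow> e > 0 \<Longrightarrow> limits_agree B (\<lambda>k. blinfun_apply (f (r k))) h e"
    using exists_subseq_limits_agree_countable[where f = "\<lambda>k. blinfun_apply (f k)" and
      D = "blinfun_apply ` D" and B = B, OF fB countable_image[OF D(1)] DB] by blast
  show thesis
  proof (rule that[OF r(1)])
    fix h and e :: real assume h: "h \<in> span S" and e: "e > 0"
    define d where "d = e / (3 * (max R 0 + 1))"
    have d: "d > 0" "d * max R 0 \<le> e / 3"
      using e by (auto simp: d_def field_simps max_def)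
    obtain g where g: "g \<in> D" "dist g h < d" using h D(3) d(1) closure_approachable by blast
    have near: "\<bar>g x - h x\<bar> \<le> e / 3" if "x \<in> B" for x
    proof -
      have "\<bar>g x - h x\<bar> \<le> norm (g - h) * max R 0" using bound[OF that, of "g - h"] by (simp add: blinfun.diff_left)
      also have "\<dots> \<le> d * max R 0" using g(2) by (intro mult_right_mono) (auto simp: dist_norm)
      finally show ?thesis using d(2) by simp
    qed
    have ag: "limits_agree B (\<lambda>k. blinfun_apply (f (r k))) (blinfun_apply g) (e / 3)"
      using r(2) g(1) e by simp
    show "limits_agree B (\<lambda>k. blinfun_apply (f (r k))) (blinfun_apply h) e"
      unfolding limits_agree_def
    proof
      fix x assume x: "x \<in> B"
      then obtain y where y: "y \<in> B" "g x + real_limsup (\<lambda>k. - f (r k) x) \<le> g y - real_limsup (\<lambda>k. f (r k) y) + e / 3"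
        using ag by (auto simp: limits_agree_def)
      show "\<exists>y\<in>B. h x + real_limsup (\<lambda>k. - f (r k) x) \<le> h y - real_limsup (\<lambda>k. f (r k) y) + e"
        using y(2) near[OF x] near[OF y(1)] by (intro bexI[OF _ y(1)]) linarith
    qed
  qed
qed

section \<open>James' theorem with a perturbation\<close>

text \<open>
  The step \<open>n\<close> chooses an almost minimizer \<open>b\<close> of \<open>\<phi> (u + \<beta> n
  a)\<close> over \<open>a \<in> A n\<close>, where \<open>u\<close> is the current partial sum. A
  further step with \<open>a \<in> A (Suc n)\<close> ends at \<open>u + (\<beta> n + \<beta> (Suc n))
  a'\<close> for a convex combination \<open>a' \<in> A n\<close>. Slopes of \<open>\<phi>\<close>
  increase along the ray from \<open>u\<close> through \<open>a'\<close>, and its slope up to \<open>u +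
  \<beta> n a'\<close> is at least that of the minimum, so \<open>\<phi>\<close> gains nearly the same
  slope again. The slope lost through almost minimizing can be kept small enough to stay above
  \<open>r\<close> forever.
\<close>

lemma james_sequence:
  fixes \<phi> :: "'v::real_vector \<Rightarrow> real" and A :: "nat \<Rightarrow> 'v set" and \<beta> :: "nat \<Rightarrow> real"
  assumes \<phi>: "convex_on UNIV \<phi>" and A: "\<And>n. convex (A n)" "\<And>n. A n \<noteq> {}" "\<And>n. A (Suc n) \<subseteq> A n"
    and \<beta>: "\<And>n. \<beta> n > 0" and s: "r < s"
    and start: "\<And>a. a \<in> A 0 \<Longrightarrow> \<phi> 0 + \<beta> 0 * s \<le> \<phi> (\<beta> 0 *\<^sub>R a)"
  obtains a where "\<And>n. a n \<in> A n"
    "\<And>n. \<phi> (\<Sum>i<n. \<beta> i *\<^sub>R a i) + \<beta> n * r \<le> \<phi> (\<Sum>i<Suc n. \<beta> i *\<^sub>R a i)"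
proof -
  define P where "P = (\<lambda>n (u, s). r < s \<and> (\<forall>a\<in>A n. \<phi> u + \<beta> n * s \<le> \<phi> (u + \<beta> n *\<^sub>R a)))"
  define Q where "Q = (\<lambda>n (u, s :: real) (u', s' :: real). \<exists>a\<in>A n. u' = u + \<beta> n *\<^sub>R a)"
  have step: "\<exists>v. P (Suc n) v \<and> Q n (u, s) v" if P: "P n (u, s)" for n u s
  proof -
    have rs: "r < s" and le: "\<And>a. a \<in> A n \<Longrightarrow> \<phi> u + \<beta> n * s \<le> \<phi> (u + \<beta> n *\<^sub>R a)"
      using P by (auto simp: P_def)
    define m where "m = (INF a\<in>A n. \<phi> (u + \<beta> n *\<^sub>R a))"
    have bdd: "bdd_below ((\<lambda>a. \<phi> (u + \<beta> n *\<^sub>R a)) ` A n)"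
      using le by (intro bdd_belowI[of _ "\<phi> u + \<beta> n * s"]) auto
    have m_le: "m \<le> \<phi> (u + \<beta> n *\<^sub>R a)" if "a \<in> A n" for a
      unfolding m_def by (rule cINF_lower[OF bdd that])
    have "\<phi> u + \<beta> n * s \<le> m" unfolding m_def by (rule cINF_greatest[OF A(2) le])
    define \<sigma> where "\<sigma> = (m - \<phi> u) / \<beta> n"
    have \<sigma>: "s \<le> \<sigma>" "m = \<phi> u + \<beta> n * \<sigma>"
      using \<open>\<phi> u + \<beta> n * s \<le> m\<close> \<beta>[of n] by (auto simp: \<sigma>_def field_simps)
    define s' where "s' = (\<sigma> + r) / 2"
    have s': "r < s'" "s' < \<sigma>" using rs \<sigma>(1) by (auto simp: s'_def)
    have "m < m + \<beta> (Suc n) * (\<sigma> - s')" using s' \<beta>[of "Suc n"] by simp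
    then obtain b where b: "b \<in> A n" "\<phi> (u + \<beta> n *\<^sub>R b) < m + \<beta> (Suc n) * (\<sigma> - s')"
      unfolding m_def using cINF_less_iff[OF A(2) bdd] by blast
    let ?v = "u + \<beta> n *\<^sub>R b"
    have "\<phi> ?v + \<beta> (Suc n) * s' \<le> \<phi> (?v + \<beta> (Suc n) *\<^sub>R a)" if a: "a \<in> A (Suc n)" for a
    proof -
      let ?\<gamma> = "\<beta> n" and ?\<delta> = "\<beta> (Suc n)"
      define t where "t = ?\<gamma> / (?\<gamma> + ?\<delta>)"
      have pos: "?\<gamma> > 0" "?\<delta> > 0" using \<beta> by auto
      have t: "t > 0" "t < 1" "t * (?\<gamma> + ?\<delta>) = ?\<gamma>" "(1 - t) * (?\<gamma> + ?\<delta>) = ?\<delta>"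
        using pos by (auto simp: t_def field_simps)
      define a' where "a' = t *\<^sub>R b + (1 - t) *\<^sub>R a"
      have "a' \<in> A n"
        unfolding a'_def using convexD[OF A(1) b(1), of a t "1 - t"] a A(3) t by auto
      have "(?\<gamma> + ?\<delta>) *\<^sub>R a' = (t * (?\<gamma> + ?\<delta>)) *\<^sub>R b + ((1 - t) * (?\<gamma> + ?\<delta>)) *\<^sub>R a"
        by (simp add: a'_def scaleR_add_right mult.commute)
      then have comb: "?v + ?\<delta> *\<^sub>R a = u + (?\<gamma> + ?\<delta>) *\<^sub>R a'" unfolding t by simp
      have "u + ?\<gamma> *\<^sub>R a' = (1 - t) *\<^sub>R u + t *\<^sub>R (u + (?\<gamma> + ?\<delta>) *\<^sub>R a')"
        using t(3) by (simp add: algebra_simps) (simp flip: scaleR_add_left distrib_left)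
      then have "\<phi> (u + ?\<gamma> *\<^sub>R a') \<le> (1 - t) * \<phi> u + t * \<phi> (?v + ?\<delta> *\<^sub>R a)"
        unfolding comb using convex_onD[OF \<phi>, of t u "u + (?\<gamma> + ?\<delta>) *\<^sub>R a'"] t(1,2) by simp
      with m_le[OF \<open>a' \<in> A n\<close>] have "m \<le> (1 - t) * \<phi> u + t * \<phi> (?v + ?\<delta> *\<^sub>R a)" by simp
      then have "(?\<gamma> + ?\<delta>) * m \<le> (?\<gamma> + ?\<delta>) * ((1 - t) * \<phi> u + t * \<phi> (?v + ?\<delta> *\<^sub>R a))"
        using pos by (intro mult_left_mono) auto
      also have "\<dots> = ((1 - t) * (?\<gamma> + ?\<delta>)) * \<phi> u + (t * (?\<gamma> + ?\<delta>)) * \<phi> (?v + ?\<delta> *\<^sub>R a)"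
        by (simp add: algebra_simps)
      finally have "(?\<gamma> + ?\<delta>) * m \<le> ?\<delta> * \<phi> u + ?\<gamma> * \<phi> (?v + ?\<delta> *\<^sub>R a)" unfolding t .
      then have "?\<gamma> * (m + ?\<delta> * \<sigma>) \<le> ?\<gamma> * \<phi> (?v + ?\<delta> *\<^sub>R a)"
        unfolding \<sigma>(2) by (simp add: algebra_simps)
      then have "m + ?\<delta> * \<sigma> \<le> \<phi> (?v + ?\<delta> *\<^sub>R a)" using pos by simp
      then show ?thesis using b(2) by (simp add: algebra_simps)
    qed
    then have "P (Suc n) (?v, s')" using s'(1) by (auto simp: P_def)
    moreover have "Q n (u, s) (?v, s')" using b(1) by (auto simp: Q_def)
    ultimately show ?thesis by blast
  qed
  have "\<exists>v. \<forall>n. (P n (v n) \<and> (n = 0 \<longrightarrow> v n = (0, s))) \<and> Q n (v n) (v (Suc n))"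
  proof (rule dependent_nat_choice)
    show "\<exists>v. P 0 v \<and> (0 = 0 \<longrightarrow> v = (0, s))" using s start by (auto simp: P_def)
    show "\<exists>v'. (P (Suc n) v' \<and> (Suc n = 0 \<longrightarrow> v' = (0, s))) \<and> Q n v v'"
      if "P n v \<and> (n = 0 \<longrightarrow> v = (0, s))" for v n
      using step[of n "fst v" "snd v"] that by auto
  qed
  then obtain v where v: "\<And>n. P n (v n)" "v 0 = (0, s)" "\<And>n. Q n (v n) (v (Suc n))" by blast
  have "\<exists>a. \<forall>n. a n \<in> A n \<and> fst (v (Suc n)) = fst (v n) + \<beta> n *\<^sub>R a n"
    using v(3) by (intro choice) (auto simp: Q_def split_beta)
  then obtain a where a: "\<And>n. a n \<in> A n" "\<And>n. fst (v (Suc n)) = fst (v n) + \<beta> n *\<^sub>R a n" by blast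
  have sum: "fst (v n) = (\<Sum>i<n. \<beta> i *\<^sub>R a i)" for n
    by (induction n) (auto simp: v(2) a(2))
  show thesis
  proof (rule that[OF a(1)])
    fix n
    have "r < snd (v n)" "\<phi> (fst (v n)) + \<beta> n * snd (v n) \<le> \<phi> (fst (v n) + \<beta> n *\<^sub>R a n)"
      using v(1)[of n] a(1)[of n] by (auto simp: P_def split_beta)
    moreover have "\<beta> n * r \<le> \<beta> n * snd (v n)" using \<beta>[of n] calculation(1) by simp
    ultimately show "\<phi> (\<Sum>i<n. \<beta> i *\<^sub>R a i) + \<beta> n * r \<le> \<phi> (\<Sum>i<Suc n. \<beta> i *\<^sub>R a i)"
      by (simp add: sum)
  qed
qed

text \<open>
  A Banach limit of the sequence of functionals: a linear functional below the sublinear functional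
  \<open>limsup H n x\<close>, and then also above \<open>liminf H n x\<close>.
\<close>

lemma exists_generalized_limit:
  fixes H :: "nat \<Rightarrow> 'a::real_normed_vector \<Rightarrow>\<^sub>L real"
  assumes H: "\<And>n. norm (H n) \<le> K"
  obtains w :: "'a \<Rightarrow>\<^sub>L real" where "norm w \<le> K" "\<And>x. w x \<le> real_limsup (\<lambda>n. H n x)"
proof -
  have K: "K \<ge> 0" using H[of 0] norm_ge_zero order_trans by blast
  have bound: "\<bar>H n x\<bar> \<le> K * norm x" for n x
    using norm_blinfun[of "H n" x] mult_right_mono[OF H norm_ge_zero, of n x] by simp
  then have bseq: "Bseq (\<lambda>n. H n x)" for x by (intro BseqI'[of _ "K * norm x"]) simp
  have "sublinear (\<lambda>x. real_limsup (\<lambda>n. H n x))"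
    unfolding sublinear_def
    using real_limsup_add_le[OF bseq bseq] real_limsup_cmult[OF bseq]
    by (simp add: blinfun.add_right blinfun.scaleR_right)
  from exists_linear_le_sublinear[OF this]
  obtain F where F: "linear F" "\<And>x. F x \<le> real_limsup (\<lambda>n. H n x)" by blast
  have "F x \<le> K * norm x" for x
    using F(2)[of x] real_limsup_abs_le[of "\<lambda>n. H n x", OF bound] by simp
  from linear_bounded_blinfun[OF F(1) this K] obtain w :: "'a \<Rightarrow>\<^sub>L real"
    where "\<And>x. w x = F x" "norm w \<le> K" by blast
  with F(2) that show thesis by simp
qed

text \<open>
  Agreement for \<open>h / c\<close>, rescaled: an upper bound of \<open>h - c limsup f\<close> on
  \<open>B\<close> also bounds \<open>h - c liminf f\<close>.
\<close>

lemma limits_agree_sup: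
  fixes B :: "'a set"
  assumes ag: "\<And>e. e > 0 \<Longrightarrow> limits_agree B f (\<lambda>x. h x / c) e" and c: "c > 0"
    and x: "x \<in> B" and le: "\<And>y. y \<in> B \<Longrightarrow> h y - c * real_limsup (\<lambda>k. f k y) \<le> m"
  shows "h x + c * real_limsup (\<lambda>k. - f k x) \<le> m"
proof (rule field_le_epsilon)
  fix e :: real assume "e > 0"
  then obtain y where y: "y \<in> B"
    "h x / c + real_limsup (\<lambda>k. - f k x) \<le> h y / c - real_limsup (\<lambda>k. f k y) + e / c"
    using ag[of "e / c"] c x by (auto simp: limits_agree_def)
  have "c * (h x / c + real_limsup (\<lambda>k. - f k x)) \<le> c * (h y / c - real_limsup (\<lambda>k. f k y) + e / c)"
    using y(2) c by (intro mult_left_mono) auto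
  then show "h x + c * real_limsup (\<lambda>k. - f k x) \<le> m + e"
    using le[OF y(1)] c by (simp add: algebra_simps)
qed

text \<open>
  The functional \<open>\<phi>\<close> lives on pairs \<open>(h, c)\<close> that stand for the functions
  \<open>h - c limsup f\<close> on \<open>B\<close>; in this way the sets \<open>A n\<close> are convex
  subsets of a vector space although \<open>limsup f\<close> is not linear. For every linear \<open>w
  \<le> limsup f\<close>, the number \<open>\<phi> (h, c)\<close> is at most the supremum of \<open>f0 +
  h - c w\<close> on \<open>B\<close>, and the agreement of the limits gives the reverse inequality
  (\<open>limit_below\<close>). So the limit functional \<open>w\<close> of the constructed \<open>h
  n\<close> may be inserted after the construction.
\<close>

lemma james_nonattaining_stable:
  fixes f :: "nat \<Rightarrow> 'a::real_normed_vector \<Rightarrow>\<^sub>L real" and f0 :: "'a \<Rightarrow>\<^sub>L real"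
  assumes B: "B \<noteq> {}" "\<And>b. b \<in> B \<Longrightarrow> norm b \<le> R"
    and C: "\<And>g c. c > 0 \<Longrightarrow> (\<And>b. b \<in> B \<Longrightarrow> blinfun_apply g b \<le> c) \<Longrightarrow> norm g \<le> C * c"
    and f: "\<And>n. norm (f n) \<le> 1" and x: "\<And>m. norm (x m) \<le> M" and \<theta>: "\<theta> > 0"
    and zero: "\<And>m. \<forall>\<^sub>F n in sequentially. f n (x m) = 0"
    and large: "\<And>n. \<forall>\<^sub>F m in sequentially. \<theta> \<le> f n (x m)"
    and agree: "\<And>h e. h \<in> span (insert f0 (range f)) \<Longrightarrow> e > 0 \<Longrightarrow>
      limits_agree B (\<lambda>k. blinfun_apply (f k)) (blinfun_apply h) e"
  shows "\<exists>g :: 'a \<Rightarrow>\<^sub>L real. (\<forall>y. (\<forall>n. f n y = 0) \<longrightarrow> blinfun_apply g y = 0) \<and>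
    \<not> (\<exists>b\<in>B. \<forall>b'\<in>B. blinfun_apply (f0 + g) b' \<le> (f0 + g) b)"
proof -
  have R: "R \<ge> 0"
  proof -
    obtain b where "b \<in> B" using B(1) by blast
    then show ?thesis using B(2)[of b] norm_ge_zero[of b] by linarith
  qed
  have apply_le: "\<bar>g b\<bar> \<le> norm g * R" if "b \<in> B" for b and g :: "'a \<Rightarrow>\<^sub>L real"
    using norm_blinfun[of g b] mult_left_mono[OF B(2)[OF that], of "norm g"] by simp
  have C0: "C \<ge> 0"
  proof -
    have "norm (0 :: 'a \<Rightarrow>\<^sub>L real) \<le> C * 1" by (rule C) auto
    then show ?thesis by simp
  qed
  define p where "p y = real_limsup (\<lambda>k. f k y)" for y
  have fK: "\<bar>f k y\<bar> \<le> norm y" for k y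
    using norm_blinfun[of "f k" y] mult_right_mono[OF f norm_ge_zero, of k y] by simp
  have bseq: "Bseq (\<lambda>k. f k y)" for y by (rule BseqI'[of _ "norm y"]) (simp add: fK)
  have p_abs: "\<bar>p y\<bar> \<le> norm y" for y
    unfolding p_def by (rule real_limsup_abs_le[OF fK])

  define \<phi> where "\<phi> = (\<lambda>(h :: 'a \<Rightarrow>\<^sub>L real, c). SUP b\<in>B. f0 b + h b - c * p b)"
  have bdd: "bdd_above ((\<lambda>b. f0 b + blinfun_apply h b - c * p b) ` B)" for h c
  proof (rule bdd_aboveI2)
    fix b assume b: "b \<in> B"
    have "\<bar>c * p b\<bar> \<le> \<bar>c\<bar> * R" unfolding abs_mult
      using p_abs[of b] B(2)[OF b] by (intro mult_left_mono) auto
    then show "f0 b + h b - c * p b \<le> norm f0 * R + norm h * R + \<bar>c\<bar> * R"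
      using apply_le[OF b, of f0] apply_le[OF b, of h] by linarith
  qed
  have \<phi>_upper: "f0 b + h b - c * p b \<le> \<phi> (h, c)" if "b \<in> B"
    for b c and h :: "'a \<Rightarrow>\<^sub>L real"
    unfolding \<phi>_def by (simp add: cSUP_upper[OF that bdd])
  have \<phi>_least: "\<phi> (h, c) \<le> m" if "\<And>b. b \<in> B \<Longrightarrow> f0 b + h b - c * p b \<le> m"
    for c m and h :: "'a \<Rightarrow>\<^sub>L real"
    unfolding \<phi>_def using cSUP_least[OF B(1) that] by simp
  have convex: "convex_on UNIV \<phi>"
  proof (rule convex_onI)
    fix t :: real and u v :: "('a \<Rightarrow>\<^sub>L real) \<times> real" assume t: "0 < t" "t < 1"
    obtain h c k d where uv: "u = (h, c)" "v = (k, d)" by (cases u, cases v)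
    have "\<phi> ((1 - t) *\<^sub>R h + t *\<^sub>R k, (1 - t) * c + t * d) \<le> (1 - t) * \<phi> u + t * \<phi> v"
    proof (rule \<phi>_least)
      fix b assume b: "b \<in> B"
      have "(1 - t) * (f0 b + h b - c * p b) + t * (f0 b + k b - d * p b) \<le> (1 - t) * \<phi> u + t * \<phi> v"
        unfolding uv using t by (intro add_mono mult_left_mono \<phi>_upper b) auto
      then show "f0 b + ((1 - t) *\<^sub>R h + t *\<^sub>R k) b - ((1 - t) * c + t * d) * p b \<le> (1 - t) * \<phi> u + t * \<phi> v"
        by (simp add: blinfun.add_left blinfun.diff_left blinfun.scaleR_left algebra_simps)
    qed
    then show "\<phi> ((1 - t) *\<^sub>R u + t *\<^sub>R v) \<le> (1 - t) * \<phi> u + t * \<phi> v" by (simp add: uv)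
  qed simp

  have limit_below: "f0 b + h b - c * w b \<le> \<phi> (h, c)"
    if w: "\<And>y. w y \<le> p y" and h: "h \<in> span (range f)" and c: "c \<ge> 0" and b: "b \<in> B"
    for w h :: "'a \<Rightarrow>\<^sub>L real" and c b
  proof (cases "c = 0")
    case True
    then show ?thesis using \<phi>_upper[OF b, of h 0] by simp
  next
    case False
    with c have c: "c > 0" by simp
    have mem: "(1 / c) *\<^sub>R (f0 + h) \<in> span (insert f0 (range f))"
      using h span_mono[OF subset_insertI, of "range f" f0]
      by (intro span_scale span_add span_base[OF insertI1]) blast
    have ag: "limits_agree B (\<lambda>k. blinfun_apply (f k)) (\<lambda>y. (f0 y + h y) / c) e" if "e > 0" for e
    proof -
      have "blinfun_apply ((1 / c) *\<^sub>R (f0 + h)) = (\<lambda>y. (f0 y + h y) / c)"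
        by (rule ext) (simp add: blinfun.add_left blinfun.scaleR_left)
      then show ?thesis using agree[OF mem that] by simp
    qed
    have "f0 b + h b + c * real_limsup (\<lambda>k. - f k b) \<le> \<phi> (h, c)"
      by (rule limits_agree_sup[OF ag c b]) (use \<phi>_upper[of _ h c] in \<open>auto simp: p_def\<close>)
    moreover have "- w b \<le> real_limsup (\<lambda>k. - f k b)"
      using w[of "- b"] by (simp add: p_def blinfun.minus_right)
    then have "c * (- w b) \<le> c * real_limsup (\<lambda>k. - f k b)" using c by (intro mult_left_mono) auto
    ultimately show ?thesis by simp
  qed

  define A where "A n = (convex hull (f ` {n..})) \<times> {1::real}" for n
  have A: "convex (A n)" "A n \<noteq> {}" "A (Suc n) \<subseteq> A n" for n
  proof -
    show "convex (A n)" by (simp add: A_def convex_Times)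
    show "A n \<noteq> {}" by (auto simp: A_def)
    have "convex hull (f ` {Suc n..}) \<subseteq> convex hull (f ` {n..})" by (intro hull_mono) auto
    then show "A (Suc n) \<subseteq> A n" by (auto simp: A_def)
  qed
  have hull_f: "h \<in> convex hull range f" if "h \<in> convex hull (f ` {n..})" for h n
    using hull_mono[of "f ` {n..}" "range f" convex] that by auto
  have hull_span: "h \<in> span (range f)" if "h \<in> convex hull (f ` {n..})" for h n
    using convex_hull_subset_span[of "range f"] hull_f[OF that] by auto
  have hull_norm: "norm h \<le> 1" if "h \<in> convex hull (f ` {n..})" for h n
  proof -
    have "convex hull (f ` {n..}) \<subseteq> cball 0 1" by (rule hull_minimal) (auto simp: f)
    then show ?thesis using that by auto
  qed
  have hull_zero: "h y = 0" if "h \<in> convex hull (f ` {n..})" "\<And>n. f n y = 0" for h n y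
  proof -
    have "convex hull (f ` {n..}) \<subseteq> {h. blinfun_apply h y = 0}"
      by (rule hull_minimal) (auto simp: that(2) convex_def blinfun.add_left blinfun.scaleR_left)
    then show ?thesis using that(1) by auto
  qed

  have M: "M > 0"
  proof -
    obtain m where "\<theta> \<le> f 0 (x m)" using eventually_happens'[OF sequentially_bot large] by blast
    then have "0 < norm (x m)" using \<theta> fK[of 0 "x m"] by linarith
    then show ?thesis using x[of m] by linarith
  qed
  define \<kappa> where "\<kappa> = \<theta> / (2 * M * (C + 1))"
  have \<kappa>: "\<kappa> > 0" using \<theta> M C0 by (simp add: \<kappa>_def)
  obtain w0 where w0: "norm w0 \<le> 1" "\<And>y. blinfun_apply w0 y \<le> p y"
    using exists_generalized_limit[of f 1, OF f] unfolding p_def by blast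
  have w0x: "w0 (x m) = 0" for m
  proof (rule antisym)
    have "p (x m) \<le> 0"
      unfolding p_def using zero[of m] by (intro real_limsup_le bseq) (auto elim!: eventually_mono)
    moreover have "p (- x m) \<le> 0"
      unfolding p_def using zero[of m]
      by (intro real_limsup_le bseq) (auto elim!: eventually_mono simp: blinfun.minus_right)
    ultimately show "w0 (x m) \<le> 0" "0 \<le> w0 (x m)"
      using w0(2)[of "x m"] w0(2)[of "- x m"] by (auto simp: blinfun.minus_right)
  qed
  (* Convex combinations of the f n are eventually at least theta at x m, whereas w0 vanishes at x m. *)
  have separated: "\<exists>b\<in>B. \<kappa> < (h - w0) b" if h: "h \<in> convex hull (f ` {0..})" for h
  proof (rule ccontr)
    assume "\<not> ?thesis"
    then have "norm (h - w0) \<le> C * \<kappa>" by (intro C \<kappa>) (auto simp: not_less)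
    also have "\<dots> \<le> (C + 1) * \<kappa>" using \<kappa> by simp
    also have "\<dots> = \<theta> / (2 * M)" using C0 by (simp add: \<kappa>_def)
    finally have norm_le: "norm (h - w0) \<le> \<theta> / (2 * M)" .
    have "convex hull (f ` {0..}) \<subseteq> {h. \<forall>\<^sub>F m in sequentially. \<theta> \<le> blinfun_apply h (x m)}"
    proof (rule hull_minimal)
      show "f ` {0..} \<subseteq> {h. \<forall>\<^sub>F m in sequentially. \<theta> \<le> blinfun_apply h (x m)}" using large by auto
      show "convex {h. \<forall>\<^sub>F m in sequentially. \<theta> \<le> blinfun_apply h (x m)}"
      proof (rule convexI)
        fix h k :: "'a \<Rightarrow>\<^sub>L real" and s t :: real
        assume "h \<in> {h. \<forall>\<^sub>F m in sequentially. \<theta> \<le> blinfun_apply h (x m)}"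
          "k \<in> {h. \<forall>\<^sub>F m in sequentially. \<theta> \<le> blinfun_apply h (x m)}"
          and st: "0 \<le> s" "0 \<le> t" "s + t = 1"
        then have "\<forall>\<^sub>F m in sequentially. \<theta> \<le> h (x m) \<and> \<theta> \<le> k (x m)" by (simp add: eventually_conj)
        then have "\<forall>\<^sub>F m in sequentially. \<theta> \<le> (s *\<^sub>R h + t *\<^sub>R k) (x m)"
        proof eventually_elim
          case (elim m)
          then have "s * \<theta> + t * \<theta> \<le> s * h (x m) + t * k (x m)"
            using st by (intro add_mono mult_left_mono) auto
          then show ?case using st by (simp add: blinfun.add_left blinfun.scaleR_left flip: distrib_right)
        qed
        then show "s *\<^sub>R h + t *\<^sub>R k \<in> {h. \<forall>\<^sub>F m in sequentially. \<theta> \<le> blinfun_apply h (x m)}" by simp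
      qed
    qed
    then have "\<forall>\<^sub>F m in sequentially. \<theta> \<le> h (x m)" using h by blast
    then obtain m where "\<theta> \<le> h (x m)" using eventually_happens'[OF sequentially_bot] by blast
    then have "\<theta> \<le> norm (h - w0) * norm (x m)"
      using norm_blinfun[of "h - w0" "x m"] by (simp add: blinfun.diff_left w0x)
    also have "\<dots> \<le> \<theta> / (2 * M) * M" using norm_le x \<theta> M by (intro mult_mono) auto
    also have "\<dots> = \<theta> / 2" using M by simp
    finally show False using \<theta> by simp
  qed

  (* beta0 makes the gain kappa beat the perturbation f0; q makes each weight dominate the later ones. *)
  define \<beta>0 where "\<beta>0 = 8 * norm f0 * R / \<kappa> + 1"
  define r where "r = \<kappa> / 2"
  define q where "q = r / (r + 4 * R + 1)"
  define \<beta> where "\<beta> n = \<beta>0 * q ^ n" for n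
  have \<beta>0: "\<beta>0 > 0" "2 * norm f0 * R \<le> \<beta>0 * (\<kappa> / 4)"
  proof -
    have "0 \<le> 8 * norm f0 * R / \<kappa>" using \<kappa> R by simp
    then show "\<beta>0 > 0" unfolding \<beta>0_def by linarith
    have "\<beta>0 * (\<kappa> / 4) = 2 * norm f0 * R + \<kappa> / 4" using \<kappa> by (simp add: \<beta>0_def field_simps)
    then show "2 * norm f0 * R \<le> \<beta>0 * (\<kappa> / 4)" using \<kappa> by linarith
  qed
  have r: "r > 0" "r < 3 / 4 * \<kappa>" using \<kappa> by (auto simp: r_def)
  have q: "0 < q" "q < 1" using r R by (auto simp: q_def)
  have q_small: "R * (2 * q / (1 - q)) \<le> r / 2"
  proof -
    have "1 - q = (4 * R + 1) / (r + 4 * R + 1)" using r R by (simp add: q_def field_simps)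
    then have "q / (1 - q) = r / (4 * R + 1)" using r R by (simp add: q_def)
    then have "R * (2 * q / (1 - q)) = 2 * R * (r / (4 * R + 1))"
      unfolding times_divide_eq_right[symmetric, of 2 q] by simp
    also have "\<dots> \<le> r / 2" using r R by (simp add: field_simps)
    finally show ?thesis .
  qed
  have \<beta>: "\<beta> n > 0" for n using \<beta>0 q by (simp add: \<beta>_def)
  have start: "\<phi> 0 + \<beta> 0 * (3 / 4 * \<kappa>) \<le> \<phi> (\<beta> 0 *\<^sub>R a)" if "a \<in> A 0" for a
  proof -
    from that obtain h where h: "a = (h, 1)" "h \<in> convex hull (f ` {0..})" by (auto simp: A_def)
    obtain b where b: "b \<in> B" "\<kappa> < (h - w0) b" using separated[OF h(2)] by blast
    have "\<phi> 0 \<le> norm f0 * R"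
      unfolding zero_prod_def by (rule \<phi>_least) (use apply_le[of _ f0] in \<open>auto simp: abs_le_iff\<close>)
    moreover have "f0 b + (\<beta>0 *\<^sub>R h) b - \<beta>0 * w0 b \<le> \<phi> (\<beta>0 *\<^sub>R h, \<beta>0)"
      using hull_span[OF h(2)] \<beta>0 b(1) by (intro limit_below w0(2) span_scale) auto
    moreover have "(\<beta>0 *\<^sub>R h) b - \<beta>0 * w0 b = \<beta>0 * (h - w0) b"
      by (simp add: blinfun.scaleR_left blinfun.diff_left right_diff_distrib)
    moreover have "\<beta>0 * \<kappa> \<le> \<beta>0 * (h - w0) b" using b(2) \<beta>0 by simp
    moreover have "- (norm f0 * R) \<le> f0 b" using apply_le[OF b(1), of f0] by linarith
    ultimately have "\<phi> 0 + \<beta>0 * (3 / 4 * \<kappa>) \<le> \<phi> (\<beta>0 *\<^sub>R h, \<beta>0)" using \<beta>0(2) by linarith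
    then show ?thesis by (simp add: \<beta>_def h(1))
  qed

  obtain a where a: "\<And>n. a n \<in> A n"
    "\<And>n. \<phi> (\<Sum>i<n. \<beta> i *\<^sub>R a i) + \<beta> n * r \<le> \<phi> (\<Sum>i<Suc n. \<beta> i *\<^sub>R a i)"
    by (rule james_sequence[where A = A and \<beta> = \<beta>, OF convex A \<beta> r(2) start]) (assumption, rule that)
  define h where "h n = fst (a n)" for n
  define H where "H n = (\<Sum>i<n. \<beta> i *\<^sub>R h i)" for n
  define c where "c n = (\<Sum>i<n. \<beta> i)" for n
  have ah: "a n = (h n, 1)" and h: "h n \<in> convex hull (f ` {n..})" for n
    using a(1)[of n] by (auto simp: A_def h_def)
  have sum_a: "(\<Sum>i<n. \<beta> i *\<^sub>R a i) = (H n, c n)" for n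
    by (simp add: prod_eq_iff fst_sum snd_sum ah H_def c_def)
  have growth: "\<phi> (H n, c n) + \<beta> n * r \<le> \<phi> (H (Suc n), c (Suc n))" for n
    using a(2)[of n] unfolding sum_a .
  have c: "c n \<ge> 0" for n unfolding c_def by (intro sum_nonneg) (simp add: \<beta> less_imp_le)
  have H_span: "H n \<in> span (range f)" for n
    unfolding H_def by (intro span_sum span_scale hull_span[OF h])

  obtain w where w: "norm w \<le> 1" "\<And>y. blinfun_apply w y \<le> real_limsup (\<lambda>n. h n y)"
    using exists_generalized_limit[of h 1, OF hull_norm[OF h]] by blast
  have hK: "\<bar>h k y\<bar> \<le> norm y" for k y
    using norm_blinfun[of "h k" y] mult_right_mono[OF hull_norm[OF h] norm_ge_zero, of k y] by simp
  have h_bseq: "Bseq (\<lambda>k. h k y)" for y by (rule BseqI'[of _ "norm y"]) (simp add: hK)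
  (* The sets convex hull (f ` {n..}) decrease, so limits of the h n are bounded by limsup f. *)
  have w_le: "w y \<le> p y" for y
  proof -
    have "real_limsup (\<lambda>n. h n y) \<le> real_limsup (\<lambda>n. f n y)"
    proof (rule real_limsup_mono_eventually[OF h_bseq bseq])
      fix c assume "\<forall>\<^sub>F k in sequentially. f k y \<le> c"
      then obtain N where N: "\<And>k. k \<ge> N \<Longrightarrow> f k y \<le> c" by (auto simp: eventually_sequentially)
      have "h n y \<le> c" if "n \<ge> N" for n
      proof -
        have "convex {h. blinfun_apply h y \<le> c}"
          using convex_linear_vimage[of "\<lambda>h. blinfun_apply h y" "{..c}"]
          by (simp add: vimage_def linear_iff blinfun.add_left blinfun.scaleR_left)
        then have "convex hull (f ` {n..}) \<subseteq> {h. blinfun_apply h y \<le> c}"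
          using N that by (intro hull_minimal) auto
        then show ?thesis using h[of n] by blast
      qed
      then show "\<forall>\<^sub>F k in sequentially. h k y \<le> c" by (auto simp: eventually_sequentially)
    qed
    then show ?thesis using w(2)[of y] by (simp add: p_def)
  qed

  define D where "D i = \<beta> i *\<^sub>R (h i - w)" for i
  define G where "G n = H n - c n *\<^sub>R w" for n
  have G: "G n = (\<Sum>i<n. D i)" for n
    by (simp add: G_def D_def H_def c_def scaleR_diff_right sum_subtractf scaleR_sum_left)
  have D_norm: "norm (D i) \<le> 2 * \<beta>0 * q ^ i" for i
  proof -
    have "norm (h i - w) \<le> 2" using norm_triangle_ineq4[of "h i" w] hull_norm[OF h[of i]] w(1) by linarith
    then have "\<beta> i * norm (h i - w) \<le> \<beta> i * 2" using \<beta>[of i] by (intro mult_left_mono) auto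
    then show ?thesis using \<beta>[of i] by (simp add: D_def \<beta>_def)
  qed
  have summable_q: "summable (\<lambda>i. 2 * \<beta>0 * q ^ i)" using q by (intro summable_mult summable_geometric) simp
  have summable_D: "summable D" by (rule summable_comparison_test'[OF summable_q, of 0]) (rule D_norm)
  define g where "g = suminf D"
  have tail: "norm (g - G n) \<le> 2 * \<beta> n / (1 - q)" for n
  proof -
    have "g - G n = (\<Sum>i. D (i + n))"
      unfolding g_def G using suminf_split_initial_segment[OF summable_D, of n] by simp
    also have "norm \<dots> \<le> (\<Sum>i. 2 * \<beta>0 * q ^ (i + n))"
      by (intro norm_suminf_le D_norm summable_ignore_initial_segment[OF summable_q])
    also have "(\<Sum>i. 2 * \<beta>0 * q ^ (i + n)) = (\<Sum>i. 2 * \<beta> n * q ^ i)"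
      by (simp add: \<beta>_def power_add mult_ac)
    also have "\<dots> = 2 * \<beta> n * (1 / (1 - q))"
      using q by (subst suminf_mult) (auto simp: suminf_geometric summable_geometric)
    finally show ?thesis by simp
  qed
  have tail_B: "\<bar>g b - G n b\<bar> \<le> 2 * \<beta> n / (1 - q) * R" if "b \<in> B" for b n
    using apply_le[OF that, of "g - G n"] mult_right_mono[OF tail R, of n] by (simp add: blinfun.diff_left)

  have "g y = 0" if y: "\<And>n. f n y = 0" for y
  proof -
    have hy: "h n y = 0" for n by (rule hull_zero[OF h y])
    have "real_limsup (\<lambda>n. h n y) \<le> 0" "real_limsup (\<lambda>n. h n (- y)) \<le> 0"
      using real_limsup_le[OF h_bseq[of y], of 0] real_limsup_le[OF h_bseq[of "- y"], of 0]
      by (auto simp: hy blinfun.minus_right)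
    then have "w y = 0" using w(2)[of y] w(2)[of "- y"] by (simp add: blinfun.minus_right)
    then have "D i y = 0" for i by (simp add: D_def blinfun.scaleR_left blinfun.diff_left hy)
    moreover have "(\<lambda>i. D i y) sums g y"
      unfolding g_def by (intro bounded_linear.sums[OF blinfun.bounded_linear_left] summable_sums summable_D)
    ultimately show ?thesis by (simp add: sums_unique2[OF _ sums_zero])
  qed
  moreover have False if b: "b \<in> B" and max: "\<And>b'. b' \<in> B \<Longrightarrow> (f0 + g) b' \<le> (f0 + g) b" for b
  proof -
    let ?V = "(f0 + g) b"
    have mono: "\<phi> (H n, c n) \<le> \<phi> (H m, c m)" if "n \<le> m" for n m
    proof (rule lift_Suc_mono_le[OF _ that])
      show "\<phi> (H n, c n) \<le> \<phi> (H (Suc n), c (Suc n))" for n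
        using growth[of n] mult_pos_pos[OF \<beta>[of n] r(1)] by linarith
    qed
    (* As w lies below limsup f, phi (H n, c n) is at most the supremum of f0 + G n, and G n tends to g. *)
    have "\<phi> (H n, c n) \<le> ?V + 2 * \<beta> n / (1 - q) * R" for n
    proof (rule \<phi>_least)
      fix b' assume b': "b' \<in> B"
      have "c n * w b' \<le> c n * p b'" using w_le c by (intro mult_left_mono) auto
      then have "f0 b' + H n b' - c n * p b' \<le> f0 b' + G n b'"
        by (simp add: G_def blinfun.diff_left blinfun.scaleR_left)
      also have "\<dots> \<le> (f0 + g) b' + 2 * \<beta> n / (1 - q) * R"
        using tail_B[OF b', of n] by (simp add: blinfun.add_left)
      also have "\<dots> \<le> ?V + 2 * \<beta> n / (1 - q) * R" using max[OF b'] by simp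
      finally show "f0 b' + H n b' - c n * p b' \<le> ?V + 2 * \<beta> n / (1 - q) * R" .
    qed
    then have "\<phi> (H n, c n) \<le> ?V + 2 * \<beta> m / (1 - q) * R" if "n \<le> m" for n m
      by (rule order_trans[OF mono[OF that]])
    moreover have "(\<lambda>m. ?V + 2 * \<beta> m / (1 - q) * R) \<longlonglongrightarrow> ?V + 2 * (\<beta>0 * 0) / (1 - q) * R"
      unfolding \<beta>_def using q by (intro tendsto_intros LIMSEQ_realpow_zero) auto
    ultimately have \<phi>_le: "\<phi> (H n, c n) \<le> ?V" for n
      by (intro LIMSEQ_le_const) auto
    (* The gain beta n * r at step n and all later steps together is covered by the terms D i b with
       i >= n, and those with i > n contribute at most half of it. *)
    have gain: "w b + r / 2 \<le> h n b" for n
    proof -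
      have "f0 b + G n b \<le> \<phi> (H n, c n)"
        using limit_below[OF w_le H_span c b, of n n] by (simp add: G_def blinfun.diff_left blinfun.scaleR_left)
      then have "f0 b + G n b + \<beta> n * r \<le> ?V" using growth[of n] \<phi>_le[of "Suc n"] by linarith
      then have "\<beta> n * r \<le> g b - G (Suc n) b + D n b"
        by (simp add: G blinfun.add_left)
      moreover have "2 * \<beta> (Suc n) / (1 - q) * R = \<beta> n * (R * (2 * q / (1 - q)))" by (simp add: \<beta>_def)
      then have "g b - G (Suc n) b \<le> \<beta> n * (r / 2)"
        using tail_B[OF b, of "Suc n"] mult_left_mono[OF q_small less_imp_le[OF \<beta>[of n]]] by linarith
      ultimately have "\<beta> n * (r / 2) \<le> D n b" by simp
      then have "\<beta> n * (r / 2) \<le> \<beta> n * (h n b - w b)"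
        by (simp add: D_def blinfun.scaleR_left blinfun.diff_left)
      then show ?thesis using \<beta>[of n] by simp
    qed
    have "real_limsup (\<lambda>n. h n (- b)) \<le> - (w b + r / 2)"
    proof (rule real_limsup_le[OF h_bseq always_eventually], rule allI)
      show "h n (- b) \<le> - (w b + r / 2)" for n using gain[of n] by (simp add: blinfun.minus_right)
    qed
    then show False using w(2)[of "- b"] r(1) by (simp add: blinfun.minus_right)
  qed
  ultimately show ?thesis by blast
qed

text \<open>
  The properties of the two sequences survive the passage to Pryce's subsequence, and the non-attaining
  functional vanishes wherever all \<open>f n\<close> do, in particular on \<open>Y\<close>. The
  constant \<open>C\<close> expresses that the supremum over \<open>B\<close> dominates the dual norm.
\<close>

theorem james_perturbed:
  fixes \<phi> :: "'a::banach \<Rightarrow>\<^sub>L real" and Phi :: "('a \<Rightarrow>\<^sub>L real) \<Rightarrow>\<^sub>L real"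
  assumes B: "B \<noteq> {}" "\<And>b. b \<in> B \<Longrightarrow> norm b \<le> R"
    and C: "\<And>g c. c > 0 \<Longrightarrow> (\<And>b. b \<in> B \<Longrightarrow> blinfun_apply g b \<le> c) \<Longrightarrow> norm g \<le> C * c"
    and Y: "finite Y"
    and attains: "\<And>g. (\<And>y. y \<in> Y \<Longrightarrow> blinfun_apply g y = 0) \<Longrightarrow> \<exists>b\<in>B. \<forall>b'\<in>B. blinfun_apply (\<phi> + g) b' \<le> (\<phi> + g) b"
  shows "\<exists>x. \<forall>f. blinfun_apply Phi f = blinfun_apply f x"
proof (rule ccontr)
  assume Phi: "\<nexists>x. \<forall>f. blinfun_apply Phi f = blinfun_apply f x"
  obtain f :: "nat \<Rightarrow> 'a \<Rightarrow>\<^sub>L real" and x \<theta> M where \<theta>: "\<theta> > 0"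
    and f: "\<And>n. norm (f n) \<le> 1" "\<And>n y. y \<in> Y \<Longrightarrow> f n y = 0" and x: "\<And>m. norm (x m) \<le> M"
    and fx: "\<And>m n. m < n \<Longrightarrow> f n (x m) = 0" "\<And>m n. n \<le> m \<Longrightarrow> \<theta> \<le> f n (x m)"
    by (rule nonreflexive_sequences[OF Phi Y]) (rule that)
  have S: "countable (insert \<phi> (range f))" by simp
  obtain r :: "nat \<Rightarrow> nat" where r: "strict_mono r"
    and agree: "\<And>h e. h \<in> span (insert \<phi> (range f)) \<Longrightarrow> e > 0 \<Longrightarrow>
      limits_agree B (\<lambda>k. blinfun_apply (f (r k))) (blinfun_apply h) e"
    by (rule pryce[where f = f and B = B]) (rule f(1), erule B(2), rule S, rule that)
  have "\<exists>g :: 'a \<Rightarrow>\<^sub>L real. (\<forall>y. (\<forall>n. f (r n) y = 0) \<longrightarrow> blinfun_apply g y = 0) \<and>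
    \<not> (\<exists>b\<in>B. \<forall>b'\<in>B. blinfun_apply (\<phi> + g) b' \<le> (\<phi> + g) b)"
  proof (rule james_nonattaining_stable[OF B C f(1) x \<theta>])
    show "\<forall>\<^sub>F n in sequentially. f (r n) (x m) = 0" for m
      using eventually_gt_at_top[of m]
    proof eventually_elim
      case (elim n)
      then show ?case using fx(1)[of m "r n"] seq_suble[OF r, of n] by simp
    qed
    show "\<forall>\<^sub>F m in sequentially. \<theta> \<le> f (r n) (x m)" for n
      using fx(2) by (auto simp: eventually_sequentially)
    have "span (insert \<phi> (range (\<lambda>n. f (r n)))) \<subseteq> span (insert \<phi> (range f))" by (intro span_mono) auto
    then show "limits_agree B (\<lambda>k. blinfun_apply (f (r k))) (blinfun_apply h) e"
      if "h \<in> span (insert \<phi> (range (\<lambda>n. f (r n))))" "e > 0" for h e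
      using agree that by blast
  qed
  then show False using attains f(2) by blast
qed

section \<open>Zeros of finitely many functionals on a line\<close>

text \<open>
  A functional that does not vanish identically on the line has at most one zero on it.
\<close>

lemma finite_zeros_on_line:
  fixes \<xi> :: "'i \<Rightarrow> 'a::real_normed_vector \<Rightarrow> 'k::real_normed_vector"
  assumes I: "finite I" and lin: "\<And>i. i \<in> I \<Longrightarrow> bounded_linear (\<xi> i)"
    and nz: "\<And>i. i \<in> I \<Longrightarrow> \<xi> i x \<noteq> 0 \<or> \<xi> i z \<noteq> 0"
  shows "finite {s. \<exists>i\<in>I. \<xi> i (x + s *\<^sub>R z) = 0}"
proof -
  have "finite {s. \<xi> i (x + s *\<^sub>R z) = 0}" if i: "i \<in> I" for i
  proof (cases "\<exists>s. \<xi> i (x + s *\<^sub>R z) = 0")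
    case True
    have eq: "\<xi> i (x + s *\<^sub>R z) = \<xi> i x + s *\<^sub>R \<xi> i z" for s
      using linear_simps[OF lin[OF i]] by simp
    from True obtain s where s: "\<xi> i x + s *\<^sub>R \<xi> i z = 0" unfolding eq by blast
    have "t = s" if "\<xi> i x + t *\<^sub>R \<xi> i z = 0" for t
    proof (rule ccontr)
      assume "t \<noteq> s"
      have "(t - s) *\<^sub>R \<xi> i z = 0"
        using arg_cong2[OF that s, of "(-)"] by (simp add: scaleR_diff_left)
      with \<open>t \<noteq> s\<close> have "\<xi> i z = 0" by simp
      with s nz[OF i] show False by simp
    qed
    then have "{s. \<xi> i (x + s *\<^sub>R z) = 0} \<subseteq> {s}" by (auto simp: eq)
    then show ?thesis by (rule finite_subset) simp
  qed simp
  moreover have "{s. \<exists>i\<in>I. \<xi> i (x + s *\<^sub>R z) = 0} = (\<Union>i\<in>I. {s. \<xi> i (x + s *\<^sub>R z) = 0})" by auto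
  ultimately show ?thesis using I by simp
qed

text \<open>
  A vector on which \<open>\<xi> j\<close> does not vanish, times a generic real scalar, is added to a
  common nonzero of the other functionals.
\<close>

lemma exists_common_nonzero:
  fixes \<xi> :: "'i \<Rightarrow> 'a::real_normed_vector \<Rightarrow> 'k::real_normed_vector"
  assumes "finite I" "\<And>i. i \<in> I \<Longrightarrow> bounded_linear (\<xi> i)" "\<And>i. i \<in> I \<Longrightarrow> \<xi> i \<noteq> (\<lambda>_. 0)"
  shows "\<exists>z. \<forall>i\<in>I. \<xi> i z \<noteq> 0"
  using assms
proof (induction I rule: finite_induct)
  case (insert j I)
  then obtain z where z: "\<forall>i\<in>I. \<xi> i z \<noteq> 0" by auto
  obtain v where v: "\<xi> j v \<noteq> 0" using insert.prems(2)[of j] by auto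
  have "finite {s. \<exists>i\<in>insert j I. \<xi> i (z + s *\<^sub>R v) = 0}"
    using insert.hyps insert.prems(1) z v by (intro finite_zeros_on_line) auto
  from ex_new_if_finite[OF infinite_UNIV_char_0 this] show ?case by blast
qed simp

section \<open>Real parts of functionals over the scalar field\<close>

text \<open>
  The map \<open>re\<close> is the identity for real scalars and the real part for complex ones. A scalar is determined
  by the numbers \<open>re (e * c)\<close> with \<open>e\<close> in the finite set \<open>E\<close>, which is \<open>{1}\<close> or \<open>{1, \<i>}\<close>; finiteness keeps
  finitely many constraints over the scalar field expressible by finitely many real ones.
\<close>

locale real_functionals = banach_space_over smul
  for smul :: "'k::real_normed_field \<Rightarrow> 'a::banach \<Rightarrow> 'a" +
  fixes re :: "'k \<Rightarrow> real" and E :: "'k set"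
  assumes re_linear: "linear re" and re_le_norm: "re c \<le> norm c" and re_of_real: "re (of_real r) = r"
    and E_finite: "finite E" and E_separates: "(\<And>e. e \<in> E \<Longrightarrow> re (e * c) = 0) \<Longrightarrow> c = 0"
    and extension: "\<exists>f\<in>dual smul. \<forall>x. re (f x) = blinfun_apply F x"
begin

lemma dualD:
  assumes "f \<in> dual smul"
  shows "bounded_linear f" "f (smul c x) = c * f x" "f (x + y) = f x + f y" "f (r *\<^sub>R x) = r *\<^sub>R f x"
    "norm (f x) \<le> onorm f * norm x"
proof -
  show b: "bounded_linear f" and "f (smul c x) = c * f x" using assms by (auto simp: dual_def)
  show "f (x + y) = f x + f y" "f (r *\<^sub>R x) = r *\<^sub>R f x" using linear_simps[OF b] by auto
  show "norm (f x) \<le> onorm f * norm x" by (rule onorm[OF b])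
qed

lemma dual_add: "f \<in> dual smul \<Longrightarrow> g \<in> dual smul \<Longrightarrow> (\<lambda>x. f x + g x) \<in> dual smul"
  by (auto simp: dual_def bounded_linear_add distrib_left)

lemma dual_cmult: "f \<in> dual smul \<Longrightarrow> (\<lambda>x. c * f x) \<in> dual smul"
  by (auto simp: dual_def bounded_linear_const_mult mult.left_commute)

lemma abs_re_le_norm: "\<bar>re c\<bar> \<le> norm c"
  using re_le_norm[of c] re_le_norm[of "- c"] linear_neg[OF re_linear, of c] by simp

lemma bounded_linear_re: "bounded_linear re"
  using abs_re_le_norm linear_add[OF re_linear] linear_cmul[OF re_linear]
  by (intro bounded_linear_intro[of _ 1]) auto

lemma exists_rotation: "\<exists>u. norm u = 1 \<and> u * c = of_real (norm c)" for c :: 'k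
proof (cases "c = 0")
  case False
  then show ?thesis by (intro exI[of _ "of_real (norm c) / c"]) (simp add: norm_divide)
qed (auto intro: exI[of _ 1])

text \<open>
  Rotating \<open>x\<close> makes \<open>f x\<close> real and nonnegative.
\<close>

lemma norm_le_of_re_le:
  assumes f: "f \<in> dual smul" and le: "\<And>x. re (f x) \<le> K * norm x"
  shows "norm (f x) \<le> K * norm x"
proof -
  obtain u where u: "norm u = 1" "u * f x = of_real (norm (f x))" using exists_rotation by blast
  have "norm (f x) = re (f (smul u x))" by (simp add: dualD(2)[OF f] u re_of_real)
  also have "\<dots> \<le> K * norm x" using le[of "smul u x"] by (simp add: norm_smul u)
  finally show ?thesis .
qed

text \<open>
  A functional is determined by its real part, since \<open>re (e * f x) = re (f (e x))\<close>.
\<close>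

lemma dual_eqI:
  assumes "f \<in> dual smul" "g \<in> dual smul" "\<And>x. re (f x) = re (g x)"
  shows "f = g"
proof
  fix x
  have "re (e * (f x - g x)) = 0" for e
    using assms(3)[of "smul e x"] linear_diff[OF re_linear]
    by (simp add: dualD(2)[OF assms(1)] dualD(2)[OF assms(2)] right_diff_distrib)
  then have "f x - g x = 0" by (rule E_separates)
  then show "f x = g x" by simp
qed

text \<open>
  Hahn-Banach gives a real support functional; its extension over the scalar field is bounded by the
  norm by rotation, and is normalized to take the value one at \<open>x\<close>.
\<close>

lemma exists_state:
  assumes "norm x = 1"
  shows "\<exists>g. (x, g) \<in> state_pairs smul"
proof -
  obtain F :: "'a \<Rightarrow>\<^sub>L real" where F: "norm F \<le> 1" "F x = norm x" using norming_functional by blast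
  obtain f where f: "f \<in> dual smul" "\<And>y. re (f y) = F y" using extension[of F] by blast
  have "F y \<le> 1 * norm y" for y
    using norm_blinfun[of F y] mult_right_mono[OF F(1), of "norm y"] by simp
  then have le: "norm (f y) \<le> 1 * norm y" for y using f by (intro norm_le_of_re_le) auto
  have fx: "norm (f x) = 1"
    using le[of x] re_le_norm[of "f x"] f(2)[of x] F(2) assms by simp
  define g where "g y = inverse (f x) * f y" for y
  have g: "g \<in> dual smul" unfolding g_def by (rule dual_cmult[OF f(1)])
  have "onorm g \<le> 1"
    by (rule onorm_bound) (use le in \<open>auto simp: g_def norm_mult norm_inverse fx\<close>)
  moreover have "f x \<noteq> 0" using fx by auto
  then have gx: "g x = 1" by (simp add: g_def)
  then have "1 \<le> onorm g" using dualD(5)[OF g, of x] assms by simp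
  ultimately show ?thesis using g gx assms by (auto simp: state_pairs_def)
qed

text \<open>
  A basic open set of the product topology restricts only finitely many coordinates.
\<close>

lemma weak_star_interior_contains_affine:
  assumes "weak_star smul interior_of S \<noteq> {}"
  obtains f0 Y where "f0 \<in> dual smul" "finite Y"
    "\<And>f. f \<in> dual smul \<Longrightarrow> \<forall>y\<in>Y. f y = f0 y \<Longrightarrow> f \<in> S"
proof -
  obtain f0 T where T: "openin (weak_star smul) T" "f0 \<in> T" "T \<subseteq> S"
    using assms by (auto simp: interior_of_def)
  then obtain W where W: "openin (product_topology (\<lambda>_. euclidean) UNIV) W" "T = W \<inter> dual smul"
    by (auto simp: weak_star_def openin_subtopology)
  have "f0 \<in> W" using T(2) W(2) by blast
  from product_topology_open_contains_basis[OF W(1) this]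
  obtain X where X: "f0 \<in> PiE UNIV X" "finite {i. X i \<noteq> UNIV}" "PiE UNIV X \<subseteq> W"
    by auto
  show thesis
  proof (rule that[OF _ X(2)])
    show "f0 \<in> dual smul" using T(2) W(2) by blast
    fix f assume f: "f \<in> dual smul" "\<forall>y\<in>{i. X i \<noteq> UNIV}. f y = f0 y"
    have "f y \<in> X y" for y using X(1) f(2) by (cases "X y = UNIV") (auto simp: PiE_iff)
    then have "f \<in> PiE UNIV X" by auto
    then show "f \<in> S" using X(3) W(2) T(3) f(1) by blast
  qed
qed

text \<open>
  A functional \<open>\<Phi>\<close> on the dual is transported to the real dual by \<open>F \<mapsto>
  re (\<Phi> f)\<close>, where \<open>f\<close> has real part \<open>F\<close>. The vector representing
  it there also represents \<open>\<Phi>\<close>, because functionals are determined by their real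
  parts.
\<close>

lemma reflexive_spaceI:
  assumes repr: "\<And>Phi :: ('a \<Rightarrow>\<^sub>L real) \<Rightarrow>\<^sub>L real. \<exists>x. \<forall>F. Phi F = blinfun_apply F x"
  shows "reflexive_space smul"
  unfolding reflexive_space_def
proof
  fix \<Phi> assume \<Phi>: "\<Phi> \<in> bidual smul"
  then obtain C where add: "\<And>f g. f \<in> dual smul \<Longrightarrow> g \<in> dual smul \<Longrightarrow> \<Phi> (\<lambda>x. f x + g x) = \<Phi> f + \<Phi> g"
    and cmult: "\<And>c f. f \<in> dual smul \<Longrightarrow> \<Phi> (\<lambda>x. c * f x) = c * \<Phi> f"
    and C: "\<And>f. f \<in> dual smul \<Longrightarrow> norm (\<Phi> f) \<le> C * onorm f"
    unfolding bidual_def by blast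
  obtain L where L: "\<And>F :: 'a \<Rightarrow>\<^sub>L real. L F \<in> dual smul" "\<And>F x. re (L F x) = blinfun_apply F x"
    using extension by metis
  have L_add: "L (F + G) = (\<lambda>x. L F x + L G x)" for F G
    by (rule dual_eqI) (auto intro: dual_add L(1) simp: L(2) linear_add[OF re_linear] blinfun.add_left)
  have L_scale: "L (r *\<^sub>R F) = (\<lambda>x. of_real r * L F x)" for r F
  proof (rule dual_eqI[OF L(1) dual_cmult[OF L(1)]])
    show "re (L (r *\<^sub>R F) x) = re (of_real r * L F x)" for x
      using linear_cmul[OF re_linear, of r "L F x"] by (simp add: L(2) blinfun.scaleR_left scaleR_conv_of_real)
  qed
  have L_norm: "onorm (L F) \<le> norm F" for F
  proof (rule onorm_bound)
    fix x
    have "re (L F y) \<le> norm F * norm y" for y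
      using norm_blinfun[of F y] by (simp add: L(2))
    then show "norm (L F x) \<le> norm F * norm x" by (rule norm_le_of_re_le[OF L(1)])
  qed simp
  define \<Psi> where "\<Psi> F = re (\<Phi> (L F))" for F
  have "bounded_linear \<Psi>"
  proof (rule bounded_linear_intro)
    show "\<Psi> (F + G) = \<Psi> F + \<Psi> G" for F G
      by (simp add: \<Psi>_def L_add add[OF L(1) L(1)] linear_add[OF re_linear])
    show "\<Psi> (r *\<^sub>R F) = r *\<^sub>R \<Psi> F" for r F
      using linear_cmul[OF re_linear, of r "\<Phi> (L F)"]
      by (simp add: \<Psi>_def L_scale cmult[OF L(1)] scaleR_conv_of_real)
    show "norm (\<Psi> F) \<le> norm F * \<bar>C\<bar>" for F
    proof -
      have "norm (\<Psi> F) \<le> norm (\<Phi> (L F))" by (simp add: \<Psi>_def abs_re_le_norm)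
      also have "\<dots> \<le> C * onorm (L F)" by (rule C[OF L(1)])
      also have "\<dots> \<le> \<bar>C\<bar> * onorm (L F)"
        using onorm_pos_le[OF dualD(1)[OF L(1)], of F] by (intro mult_right_mono) auto
      also have "\<dots> \<le> \<bar>C\<bar> * norm F" by (intro mult_left_mono L_norm) simp
      finally show ?thesis by (simp add: mult.commute)
    qed
  qed
  then have "blinfun_apply (Blinfun \<Psi>) = \<Psi>" by (rule bounded_linear_Blinfun_apply)
  with repr[of "Blinfun \<Psi>"] obtain x where x: "\<And>F. \<Psi> F = blinfun_apply F x" by auto
  have re_eq: "re (\<Phi> f) = re (f x)" if f: "f \<in> dual smul" for f
  proof -
    have "bounded_linear (\<lambda>y. re (f y))"
      using bounded_linear_compose[OF bounded_linear_re dualD(1)[OF f]] .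
    then have F: "blinfun_apply (Blinfun (\<lambda>y. re (f y))) = (\<lambda>y. re (f y))" by (rule bounded_linear_Blinfun_apply)
    then have "L (Blinfun (\<lambda>y. re (f y))) = f" by (intro dual_eqI L(1) f) (simp add: L(2))
    then show ?thesis using x[of "Blinfun (\<lambda>y. re (f y))"] F by (simp add: \<Psi>_def)
  qed
  have "\<Phi> f = f x" if f: "f \<in> dual smul" for f
  proof -
    have "re (e * (\<Phi> f - f x)) = 0" for e
      using re_eq[OF dual_cmult[OF f, of e]] linear_diff[OF re_linear]
      by (simp add: cmult[OF f] right_diff_distrib)
    then have "\<Phi> f - f x = 0" by (rule E_separates)
    then show ?thesis by simp
  qed
  then show "\<exists>x. \<forall>f\<in>dual smul. \<Phi> f = f x" by blast
qed

section \<open>The set that determines the numerical radius\<close>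

context
  fixes N :: nat and xs :: "nat \<Rightarrow> 'a \<Rightarrow> 'k" and x0 :: 'a
  assumes x0: "x0 \<noteq> 0" and xs: "\<And>i. i \<in> {1..N - 1} \<Longrightarrow> xs i \<in> dual smul \<and> xs i \<noteq> (\<lambda>_. 0)"
begin

definition radius_set :: "'a set" where
  "radius_set = {smul (c * ((\<Prod>i\<in>{1..N - 1}. xs i x) * g x0)) x | c x g.
     norm c = 1 \<and> (x, g) \<in> state_pairs smul}"

lemma norm_prod_le:
  assumes "norm x = 1"
  shows "norm (\<Prod>i\<in>{1..N - 1}. xs i x) \<le> (\<Prod>i\<in>{1..N - 1}. onorm (xs i))"
  unfolding prod_norm[symmetric]
  using dualD(5)[of "xs _" x] xs assms by (intro prod_mono) auto

lemma radius_set_bounded: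
  assumes "b \<in> radius_set"
  shows "norm b \<le> (\<Prod>i\<in>{1..N - 1}. onorm (xs i)) * norm x0"
proof -
  obtain c x g where b: "b = smul (c * ((\<Prod>i\<in>{1..N - 1}. xs i x) * g x0)) x" "norm c = 1"
    and st: "(x, g) \<in> state_pairs smul" using assms by (auto simp: radius_set_def)
  have g: "norm x = 1" "g \<in> dual smul" "onorm g = 1" using st by (auto simp: state_pairs_def)
  have "norm b = norm (\<Prod>i\<in>{1..N - 1}. xs i x) * norm (g x0)"
    using b g(1) by (simp add: norm_smul norm_mult)
  also have "\<dots> \<le> (\<Prod>i\<in>{1..N - 1}. onorm (xs i)) * norm x0"
    using norm_prod_le[OF g(1)] dualD(5)[OF g(2), of x0] g(3)
    by (intro mult_mono order_trans[OF norm_ge_zero norm_prod_le[OF g(1)]]) auto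
  finally show ?thesis .
qed

lemma radius_set_uminus: "b \<in> radius_set \<Longrightarrow> - b \<in> radius_set"
proof -
  assume "b \<in> radius_set"
  then obtain c x g where b: "b = smul (c * ((\<Prod>i\<in>{1..N - 1}. xs i x) * g x0)) x" "norm c = 1"
    "(x, g) \<in> state_pairs smul" by (auto simp: radius_set_def)
  then have "- b = smul (- c * ((\<Prod>i\<in>{1..N - 1}. xs i x) * g x0)) x" "norm (- c) = 1" by simp_all
  with b(3) show "- b \<in> radius_set" unfolding radius_set_def by blast
qed

lemma radius_set_nonempty: "radius_set \<noteq> {}"
proof -
  have "norm ((1 / norm x0) *\<^sub>R x0) = 1" using x0 by simp
  from exists_state[OF this] obtain g where "((1 / norm x0) *\<^sub>R x0, g) \<in> state_pairs smul" ..
  moreover have "norm (1 :: 'k) = 1" by simp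
  ultimately show ?thesis unfolding radius_set_def by blast
qed

text \<open>
  The value of the polynomial at a state pair has the modulus of \<open>f\<close> at the corresponding
  elements of \<open>radius_set\<close>, and the unimodular factor can be chosen such that
  \<open>f\<close> is real and nonnegative there.
\<close>

lemma attains_max_on_radius_set:
  assumes f: "f \<in> dual smul" and att: "attains_numerical_radius smul (product_poly smul N xs f x0)"
  shows "\<exists>b\<in>radius_set. \<forall>b'\<in>radius_set. re (f b') \<le> re (f b)"
proof -
  define p where "p x = (\<Prod>i\<in>{1..N - 1}. xs i x)" for x
  define v where "v = (\<lambda>(x, g). norm (p x * g x0 * f x))"
  have v: "norm (g (product_poly smul N xs f x0 x)) = v (x, g)" if "(x, g) \<in> state_pairs smul" for x g
    using that dualD(2)[of g] by (simp add: state_pairs_def product_poly_def p_def v_def mult_ac)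
  have "v s \<le> (\<Prod>i\<in>{1..N - 1}. onorm (xs i)) * norm x0 * onorm f" if "s \<in> state_pairs smul" for s
  proof -
    obtain x g where s: "s = (x, g)" by (cases s)
    then have g: "norm x = 1" "g \<in> dual smul" "onorm g = 1" using that by (auto simp: state_pairs_def)
    have "v s = norm (p x) * norm (g x0) * norm (f x)" by (simp add: s v_def norm_mult)
    also have "\<dots> \<le> (\<Prod>i\<in>{1..N - 1}. onorm (xs i)) * norm x0 * onorm f"
      using norm_prod_le[OF g(1)] dualD(5)[OF g(2), of x0] dualD(5)[OF f, of x] g order_trans[OF norm_ge_zero norm_prod_le[OF g(1)]]
      unfolding p_def by (intro mult_mono) (auto intro!: mult_nonneg_nonneg)
    finally show ?thesis .
  qed
  then have bdd: "bdd_above (v ` state_pairs smul)" by (rule bdd_aboveI2)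
  have nr: "numerical_radius smul (product_poly smul N xs f x0) = (SUP s\<in>state_pairs smul. v s)"
    unfolding numerical_radius_def by (rule SUP_cong) (auto simp: v)
  obtain x g where xg: "(x, g) \<in> state_pairs smul" and max: "\<And>s. s \<in> state_pairs smul \<Longrightarrow> v s \<le> v (x, g)"
    using att nr v cSUP_upper[OF _ bdd] unfolding attains_numerical_radius_def by fastforce
  obtain u where u: "norm u = 1" "u * (p x * g x0 * f x) = of_real (norm (p x * g x0 * f x))"
    using exists_rotation by blast
  define b where "b = smul (u * (p x * g x0)) x"
  have "b \<in> radius_set" unfolding radius_set_def b_def p_def using u(1) xg by blast
  moreover have "re (f b') \<le> re (f b)" if mem: "b' \<in> radius_set" for b'
  proof -
    obtain c y h where b': "b' = smul (c * (p y * h x0)) y" "norm c = 1" "(y, h) \<in> state_pairs smul"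
      using mem unfolding radius_set_def p_def by blast
    have "re (f b') \<le> norm (f b')" by (rule re_le_norm)
    also have "\<dots> = v (y, h)" by (simp add: b' dualD(2)[OF f] v_def norm_mult)
    also have "\<dots> \<le> v (x, g)" by (rule max[OF b'(3)])
    also have "\<dots> = re (f b)" using u(2) by (simp add: b_def dualD(2)[OF f] v_def mult.assoc re_of_real)
    finally show ?thesis .
  qed
  ultimately show ?thesis by blast
qed

text \<open>
  A support functional \<open>g\<close> at \<open>x\<close> with \<open>g x0 = 0\<close> would be
  constant on the line through \<open>x\<close> in the direction \<open>x0\<close>, so \<open>x\<close>
  would have least norm on it.
\<close>

lemma mem_span_radius_set:
  assumes nz: "\<And>i. i \<in> {1..N - 1} \<Longrightarrow> xs i x \<noteq> 0" and t: "norm (x + t *\<^sub>R x0) < norm x"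
  shows "x \<in> Real_Vector_Spaces.span radius_set"
proof -
  define r where "r = norm x"
  have r: "r > 0" using t norm_ge_zero[of "x + t *\<^sub>R x0"] unfolding r_def by linarith
  define u where "u = (1 / r) *\<^sub>R x"
  have u: "norm u = 1" "x = r *\<^sub>R u" using r by (auto simp: u_def r_def)
  obtain g where st: "(u, g) \<in> state_pairs smul" using exists_state[OF u(1)] by blast
  then have g: "g \<in> dual smul" "onorm g = 1" "g u = 1" by (auto simp: state_pairs_def)
  have "g x0 \<noteq> 0"
  proof
    assume "g x0 = 0"
    then have "g (x + t *\<^sub>R x0) = of_real r"
      using dualD(3,4)[OF g(1)] g(3) u(2) by (simp add: scaleR_conv_of_real)
    then have "r \<le> norm (x + t *\<^sub>R x0)"
      using dualD(5)[OF g(1), of "x + t *\<^sub>R x0"] g(2) r by simp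
    with t show False by (simp add: r_def)
  qed
  moreover have "xs i u \<noteq> 0" if "i \<in> {1..N - 1}" for i
    using nz[OF that] xs[OF that] dualD(4)[of "xs i" r u] u(2) by auto
  ultimately have k: "(\<Prod>i\<in>{1..N - 1}. xs i u) * g x0 \<noteq> 0" (is "?k \<noteq> 0") by simp
  obtain c where c: "norm c = 1" "c * ?k = of_real (norm ?k)" using exists_rotation by blast
  have "smul (c * ?k) u \<in> radius_set" unfolding radius_set_def using c(1) st by blast
  then have "norm ?k *\<^sub>R u \<in> Real_Vector_Spaces.span radius_set" unfolding c(2) smul_of_real by (rule real_vector.span_base)
  then have "(r / norm ?k) *\<^sub>R (norm ?k *\<^sub>R u) \<in> Real_Vector_Spaces.span radius_set" by (rule real_vector.span_scale)
  then show ?thesis using k by (simp add: u(2))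
qed

text \<open>
  If no \<open>xs i\<close> vanishes at \<open>x\<close>, then two different points \<open>x + s
  x0\<close> and \<open>x + t x0\<close> far out on the line lie in the span by the previous lemma.
  Hence so do their multiple \<open>x0\<close> of the difference and \<open>x\<close> itself. An
  arbitrary vector is a combination of two vectors where no \<open>xs i\<close> vanishes.
\<close>

lemma span_radius_set: "Real_Vector_Spaces.span radius_set = UNIV"
proof -
  have lin: "bounded_linear (xs i)" if "i \<in> {1..N - 1}" for i using xs[OF that] dualD(1) by blast
  have generic: "x \<in> Real_Vector_Spaces.span radius_set" if nz: "\<And>i. i \<in> {1..N - 1} \<Longrightarrow> xs i x \<noteq> 0" for x
  proof -
    define bad where "bad = {s. \<exists>i\<in>{1..N - 1}. xs i (x + s *\<^sub>R x0) = 0}"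
    have fin: "finite bad" unfolding bad_def using lin nz by (intro finite_zeros_on_line) auto
    have y: "x + s *\<^sub>R x0 \<in> Real_Vector_Spaces.span radius_set" if s: "s \<in> {2 * norm x / norm x0<..} - bad" for s
    proof (rule mem_span_radius_set)
      have "2 * norm x < s * norm x0" using s x0 by (auto simp: field_simps)
      moreover have "s > 0" using s order_le_less_trans[of 0 "2 * norm x / norm x0" s] by auto
      ultimately have "norm x < norm (x + s *\<^sub>R x0)"
        using norm_triangle_ineq4[of "x + s *\<^sub>R x0" x] by simp
      then show "norm (x + s *\<^sub>R x0 + (- s) *\<^sub>R x0) < norm (x + s *\<^sub>R x0)" by simp
    qed (use s in \<open>auto simp: bad_def\<close>)
    have inf: "infinite ({2 * norm x / norm x0<..} - bad)"
      using Diff_infinite_finite[OF fin infinite_Ioi] .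
    from infinite_imp_nonempty[OF this] obtain s where s: "s \<in> {2 * norm x / norm x0<..} - bad" by blast
    have "infinite ({2 * norm x / norm x0<..} - bad - {s})" using inf by simp
    from infinite_imp_nonempty[OF this] obtain t where t: "t \<in> {2 * norm x / norm x0<..} - bad" "t \<noteq> s"
      by blast
    have "(1 / (t - s)) *\<^sub>R ((x + t *\<^sub>R x0) - (x + s *\<^sub>R x0)) \<in> Real_Vector_Spaces.span radius_set"
      by (intro real_vector.span_scale real_vector.span_diff y s t)
    also have "(1 / (t - s)) *\<^sub>R ((x + t *\<^sub>R x0) - (x + s *\<^sub>R x0)) = x0"
      using t(2) by (simp flip: scaleR_diff_left)
    finally have "(x + s *\<^sub>R x0) - s *\<^sub>R x0 \<in> Real_Vector_Spaces.span radius_set" by (intro real_vector.span_diff real_vector.span_scale y s)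
    then show ?thesis by simp
  qed
  obtain z where z: "\<forall>i\<in>{1..N - 1}. xs i z \<noteq> 0"
    using exists_common_nonzero[of "{1..N - 1}" xs] lin xs by auto
  have "x \<in> Real_Vector_Spaces.span radius_set" for x
  proof -
    have "finite {s. \<exists>i\<in>{1..N - 1}. xs i (x + s *\<^sub>R z) = 0}"
      using lin z by (intro finite_zeros_on_line) auto
    from ex_new_if_finite[OF infinite_UNIV_char_0 this]
    obtain s where "\<forall>i\<in>{1..N - 1}. xs i (x + s *\<^sub>R z) \<noteq> 0" by blast
    then have "(x + s *\<^sub>R z) - s *\<^sub>R z \<in> Real_Vector_Spaces.span radius_set"
      using z by (intro real_vector.span_diff real_vector.span_scale generic) auto
    then show ?thesis by simp
  qed
  then show ?thesis by blast
qed

text \<open>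
  The functionals bounded by one on \<open>radius_set\<close> are pointwise bounded on its span, which
  is the whole space, so the Banach-Steinhaus theorem applies.
\<close>

lemma radius_set_norming:
  obtains C where "\<And>g c. c > 0 \<Longrightarrow> (\<And>b. b \<in> radius_set \<Longrightarrow> blinfun_apply g b \<le> c) \<Longrightarrow> norm g \<le> C * c"
proof -
  define T where "T = {g :: 'a \<Rightarrow>\<^sub>L real. \<forall>b\<in>radius_set. blinfun_apply g b \<le> 1}"
  define Z where "Z = {x. \<exists>K. \<forall>g\<in>T. \<bar>blinfun_apply g x\<bar> \<le> K}"
  have "Real_Vector_Spaces.subspace Z"
    unfolding real_vector.subspace_def
  proof (intro conjI ballI allI)
    show "0 \<in> Z" by (auto simp: Z_def)
  next
    fix x y assume "x \<in> Z" "y \<in> Z"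
    then obtain K L where "\<forall>g\<in>T. \<bar>blinfun_apply g x\<bar> \<le> K" "\<forall>g\<in>T. \<bar>blinfun_apply g y\<bar> \<le> L" by (auto simp: Z_def)
    then have "\<forall>g\<in>T. \<bar>blinfun_apply g (x + y)\<bar> \<le> K + L" by (force simp: blinfun.add_right)
    then show "x + y \<in> Z" unfolding Z_def by blast
  next
    fix c x assume "x \<in> Z"
    then obtain K where "\<forall>g\<in>T. \<bar>blinfun_apply g x\<bar> \<le> K" by (auto simp: Z_def)
    then have "\<forall>g\<in>T. \<bar>blinfun_apply g (c *\<^sub>R x)\<bar> \<le> \<bar>c\<bar> * K"
      by (simp add: blinfun.scaleR_right abs_mult mult_left_mono)
    then show "c *\<^sub>R x \<in> Z" unfolding Z_def by blast
  qed
  moreover have "radius_set \<subseteq> Z"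
  proof
    fix b assume b: "b \<in> radius_set"
    have "\<bar>blinfun_apply g b\<bar> \<le> 1" if "g \<in> T" for g
      using that b radius_set_uminus[OF b] by (force simp: T_def blinfun.minus_right abs_le_iff)
    then show "b \<in> Z" unfolding Z_def by blast
  qed
  ultimately have "Real_Vector_Spaces.span radius_set \<subseteq> Z" by (rule real_vector.span_minimal[rotated])
  then have "\<And>x. \<exists>K. \<forall>g\<in>T. \<bar>blinfun_apply g x\<bar> \<le> K" using span_radius_set by (auto simp: Z_def)
  then obtain C where C: "\<And>g. g \<in> T \<Longrightarrow> norm g \<le> C" by (rule banach_steinhaus_functionals) blast
  show thesis
  proof (rule that)
    fix g :: "'a \<Rightarrow>\<^sub>L real" and c :: real
    assume c: "c > 0" and le: "\<And>b. b \<in> radius_set \<Longrightarrow> blinfun_apply g b \<le> c"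
    have "(1 / c) *\<^sub>R g \<in> T" using c le by (auto simp: T_def blinfun.scaleR_left field_simps)
    from C[OF this] show "norm g \<le> C * c" using c by (simp add: field_simps)
  qed
qed

theorem reflexive_if_interior:
  assumes "weak_star smul interior_of
    {f \<in> dual smul. attains_numerical_radius smul (product_poly smul N xs f x0)} \<noteq> {}"
  shows "reflexive_space smul"
proof (rule reflexive_spaceI)
  fix Phi :: "('a \<Rightarrow>\<^sub>L real) \<Rightarrow>\<^sub>L real"
  obtain f0 Y where f0: "f0 \<in> dual smul" and Y: "finite Y"
    and att: "\<And>f. f \<in> dual smul \<Longrightarrow> \<forall>y\<in>Y. f y = f0 y \<Longrightarrow>
      f \<in> {f \<in> dual smul. attains_numerical_radius smul (product_poly smul N xs f x0)}"
    using weak_star_interior_contains_affine[OF assms] by blast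
  obtain C where C: "\<And>g c. c > 0 \<Longrightarrow> (\<And>b. b \<in> radius_set \<Longrightarrow> blinfun_apply g b \<le> c) \<Longrightarrow> norm g \<le> C * c"
    using radius_set_norming by blast
  define F0 where "F0 = Blinfun (\<lambda>x. re (f0 x))"
  have F0: "blinfun_apply F0 x = re (f0 x)" for x
    unfolding F0_def using bounded_linear_compose[OF bounded_linear_re dualD(1)[OF f0]]
    by (simp add: bounded_linear_Blinfun_apply)
  let ?Y = "(\<lambda>(e, y). smul e y) ` (E \<times> Y)"
  show "\<exists>x. \<forall>F. Phi F = blinfun_apply F x"
  proof (rule james_perturbed[where B = radius_set and Y = ?Y and \<phi> = F0, OF radius_set_nonempty radius_set_bounded C])
    show "finite ?Y" using E_finite Y by simp
    fix g :: "'a \<Rightarrow>\<^sub>L real" assume g: "\<And>y. y \<in> ?Y \<Longrightarrow> blinfun_apply g y = 0"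
    obtain f where f: "f \<in> dual smul" "\<And>x. re (f x) = g x" using extension[of g] by blast
    have "f y = 0" if "y \<in> Y" for y
    proof (rule E_separates)
      show "re (e * f y) = 0" if "e \<in> E" for e
        using g[of "smul e y"] f(2)[of "smul e y"] dualD(2)[OF f(1)] that \<open>y \<in> Y\<close> by force
    qed
    then have "attains_numerical_radius smul (product_poly smul N xs (\<lambda>x. f0 x + f x) x0)"
      using att[OF dual_add[OF f0 f(1)]] by simp
    from attains_max_on_radius_set[OF dual_add[OF f0 f(1)] this]
    show "\<exists>b\<in>radius_set. \<forall>b'\<in>radius_set. blinfun_apply (F0 + g) b' \<le> blinfun_apply (F0 + g) b"
      by (simp add: blinfun.add_left F0 f(2) linear_add[OF re_linear])
  qed
qed

end

end

section \<open>Real and complex scalars\<close>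

lemma real_functionals_real: "real_functionals (scaleR :: real \<Rightarrow> 'a::banach \<Rightarrow> 'a) (\<lambda>c. c) {1}"
proof -
  interpret banach_space_over "scaleR :: real \<Rightarrow> 'a \<Rightarrow> 'a" by (rule banach_space_over_scaleR)
  show ?thesis
  proof
    fix F :: "'a \<Rightarrow>\<^sub>L real"
    show "\<exists>f\<in>dual scaleR. \<forall>x. f x = blinfun_apply F x"
      by (auto simp: dual_scaleR intro: blinfun.bounded_linear_right)
  qed (auto simp: linear_iff)
qed

text \<open>
  The complex functional with real part \<open>F\<close> is \<open>x \<mapsto> F x - \<i> F (\<i>
  x)\<close>.
\<close>

lemma real_functionals_complex:
  fixes smul :: "complex \<Rightarrow> 'a::banach \<Rightarrow> 'a"
  assumes "banach_space_over smul"
  shows "real_functionals smul Re {1, \<i>}"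
proof -
  interpret banach_space_over smul by (rule assms)
  have split: "smul c x = Re c *\<^sub>R x + Im c *\<^sub>R smul \<i> x" for c x
  proof -
    have "c = of_real (Re c) + of_real (Im c) * \<i>" by (simp add: complex_eq mult.commute)
    then have "smul c x = smul (of_real (Re c) + of_real (Im c) * \<i>) x" by simp
    also have "\<dots> = Re c *\<^sub>R x + Im c *\<^sub>R smul \<i> x"
      by (simp only: scale_left_distrib smul_of_real flip: scale_scale)
    finally show ?thesis .
  qed
  show ?thesis
  proof
    show "c = 0" if "\<And>e. e \<in> {1, \<i>} \<Longrightarrow> Re (e * c) = 0" for c
      using that[of 1] that[of \<i>] by (simp add: complex_eq_iff)
    fix F :: "'a \<Rightarrow>\<^sub>L real"
    define f where "f x = Complex (F x) (- F (smul \<i> x))" for x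
    have hom: "f (smul c x) = c * f x" for c x
    proof -
      have "smul \<i> (smul c x) = smul (\<i> * c) x" by simp
      also have "\<dots> = - Im c *\<^sub>R x + Re c *\<^sub>R smul \<i> x" using split[of "\<i> * c" x] by simp
      finally have "F (smul \<i> (smul c x)) = - Im c * F x + Re c * F (smul \<i> x)"
        by (simp add: blinfun.diff_right blinfun.scaleR_right)
      moreover have "F (smul c x) = Re c * F x + Im c * F (smul \<i> x)"
        unfolding split[of c x] by (simp add: blinfun.add_right blinfun.scaleR_right)
      ultimately show ?thesis by (simp only: f_def) (simp add: complex_eq_iff)
    qed
    have "bounded_linear f"
    proof (rule bounded_linear_intro)
      show "f (x + y) = f x + f y" for x y
        by (simp add: f_def complex_eq_iff blinfun.add_right scale_right_distrib)
      show "f (r *\<^sub>R x) = r *\<^sub>R f x" for r x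
        using hom[of "of_real r" x] by (simp add: smul_of_real scaleR_conv_of_real)
      show "norm (f x) \<le> norm x * (2 * norm F)" for x
      proof -
        have "norm (f x) \<le> \<bar>F x\<bar> + \<bar>F (smul \<i> x)\<bar>"
          using cmod_le[of "f x"] by (simp add: f_def)
        also have "\<dots> \<le> norm F * norm x + norm F * norm x"
          using norm_blinfun[of F x] norm_blinfun[of F "smul \<i> x"]
          by (intro add_mono) (simp_all add: norm_smul)
        finally show ?thesis by (simp add: algebra_simps)
      qed
    qed
    then have "f \<in> dual smul" using hom by (simp add: dual_def)
    moreover have "\<forall>x. Re (f x) = F x" by (simp add: f_def)
    ultimately show "\<exists>f\<in>dual smul. \<forall>x. Re (f x) = blinfun_apply F x" by blast
  qed (auto simp: linear_iff complex_Re_le_cmod)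
qed

theorem theorem3p2:
  fixes N :: nat
  assumes "N \<ge> 1"
  shows
    "((\<exists>(x0 :: 'a::banach) xs.
         x0 \<noteq> 0 \<and>
         (\<forall>i\<in>{1..N - 1}. xs i \<in> dual (scaleR :: real \<Rightarrow> 'a \<Rightarrow> 'a) \<and> xs i \<noteq> (\<lambda>_. 0)) \<and>
         weak_star (scaleR :: real \<Rightarrow> 'a \<Rightarrow> 'a) interior_of
           {f \<in> dual (scaleR :: real \<Rightarrow> 'a \<Rightarrow> 'a).
              attains_numerical_radius (scaleR :: real \<Rightarrow> 'a \<Rightarrow> 'a) (product_poly scaleR N xs f x0)}
           \<noteq> {})
       \<longrightarrow> reflexive_space (scaleR :: real \<Rightarrow> 'a \<Rightarrow> 'a))
     \<and>
     (\<forall>scaleC :: complex \<Rightarrow> 'b::banach \<Rightarrow> 'b.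
       banach_space_over scaleC \<longrightarrow>
       (\<exists>x0 xs.
         x0 \<noteq> 0 \<and>
         (\<forall>i\<in>{1..N - 1}. xs i \<in> dual scaleC \<and> xs i \<noteq> (\<lambda>_. 0)) \<and>
         weak_star scaleC interior_of
           {f \<in> dual scaleC.
              attains_numerical_radius scaleC (product_poly scaleC N xs f x0)}
           \<noteq> {})
       \<longrightarrow> reflexive_space scaleC)"
proof (intro conjI impI allI)
  show "reflexive_space (scaleR :: real \<Rightarrow> 'a \<Rightarrow> 'a)"
    if "\<exists>(x0 :: 'a) xs.
         x0 \<noteq> 0 \<and>
         (\<forall>i\<in>{1..N - 1}. xs i \<in> dual (scaleR :: real \<Rightarrow> 'a \<Rightarrow> 'a) \<and> xs i \<noteq> (\<lambda>_. 0)) \<and>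
         weak_star (scaleR :: real \<Rightarrow> 'a \<Rightarrow> 'a) interior_of
           {f \<in> dual (scaleR :: real \<Rightarrow> 'a \<Rightarrow> 'a).
              attains_numerical_radius (scaleR :: real \<Rightarrow> 'a \<Rightarrow> 'a) (product_poly scaleR N xs f x0)}
           \<noteq> {}"
    using that by (elim exE conjE) (rule real_functionals.reflexive_if_interior[OF real_functionals_real], auto)
next
  fix scaleC :: "complex \<Rightarrow> 'b \<Rightarrow> 'b"
  assume C: "banach_space_over scaleC"
  show "reflexive_space scaleC"
    if "\<exists>x0 xs.
         x0 \<noteq> 0 \<and>
         (\<forall>i\<in>{1..N - 1}. xs i \<in> dual scaleC \<and> xs i \<noteq> (\<lambda>_. 0)) \<and>
         weak_star scaleC interior_of
           {f \<in> dual scaleC.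
              attains_numerical_radius scaleC (product_poly scaleC N xs f x0)}
           \<noteq> {}"
    using that by (elim exE conjE) (rule real_functionals.reflexive_if_interior[OF real_functionals_complex[OF C]], auto)
qed

end
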